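(* Let $\mathfrak{A}$ be a $(k,p,q)$-differential subalgebra of the $C^*$-algebra $\mathfrak{B}$. Then ${\rm Spec}_{\mathfrak{A}}(a)={\rm Spec}_{\mathfrak{B}}(a)$ for all $a\in\mathfrak{A}$. In particular, $\mathfrak{A}$ is symmetric.
   Context: Let $\mathfrak{B}$ be a $C^*$-algebra with norm $\|\cdot\|_{\mathfrak{B}}$. A $(k,p,q)$-differential subalgebra of $\mathfrak{B}$ is a $*$-subalgebra $\mathfrak{A}\subseteq\mathfrak{B}$ equipped with its own norm $\|\cdot\|_{\mathfrak{A}}$ making it a Banach $*$-algebra on which the involution is continuous, where $k\in\mathbb{Z}$, $k\geq 2$, and $p,q>0$ are reals with $p+q=k$, such that for some constant $C>0$, $\|a^k\|_{\mathfrak{A}}\leq C\|a\|_{\mathfrak{A}}^p\|a\|_{\mathfrak{B}}^q$ for all $a\in\mathfrak{A}$. For a Banach algebra $\mathfrak{D}$ and $a\in\mathfrak{D}$, ${\rm Spec}_{\mathfrak{D}}(a)$ is the set of $\lambda\in\mathbb{C}$ such that $a-\lambda 1$ is not invertible in the minimal unitization $\widetilde{\mathfrak{D}}$ (with $\widetilde{\mathfrak{D}}=\mathfrak{D}$ if $\mathfrak{D}$ is unital). A Banach $*$-algebra is symmetric if ${\rm Spec}(a^*a)\subseteq[0,\infty)$ for every element $a$.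
   Formalization: In the equality of spectra, the subalgebra counts as unital only if it contains the unit of the C*-algebra; otherwise its spectrum is taken in the unitization. With its own different unit the literal claim fails (e.g. the span of e_1 in C^2). *)

theory Defs
  imports "HOL-Analysis.Analysis"
begin

text \<open>The C*-algebra B is modelled as a type 'b of class real_normed_algebra
  and banach (ring operations, submultiplicative norm, completeness), together with
  an explicit complex scalar multiplication sm and an involution st.
  The algebra is not assumed to be unital.\<close>

definition cstar_algebra :: "(complex \<Rightarrow> 'b::{real_normed_algebra,banach} \<Rightarrow> 'b) \<Rightarrow> ('b \<Rightarrow> 'b) \<Rightarrow> bool" where
  "cstar_algebra sm st \<longleftrightarrow>
     (\<forall>r x. sm (complex_of_real r) x = scaleR r x) \<and>
     (\<forall>c d x. sm (c + d) x = sm c x + sm d x) \<and>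
     (\<forall>c x y. sm c (x + y) = sm c x + sm c y) \<and>
     (\<forall>c d x. sm (c * d) x = sm c (sm d x)) \<and>
     (\<forall>c x y. sm c (x * y) = sm c x * y \<and> sm c (x * y) = x * sm c y) \<and>
     (\<forall>c x. norm (sm c x) = cmod c * norm x) \<and>
     (\<forall>x. st (st x) = x) \<and>
     (\<forall>x y. st (x + y) = st x + st y) \<and>
     (\<forall>c x. st (sm c x) = sm (cnj c) (st x)) \<and>
     (\<forall>x y. st (x * y) = st y * st x) \<and>
     (\<forall>x. norm (st x * x) = (norm x)\<^sup>2)"

text \<open>Positive powers: ppow a n = a^(n+1) (no unit needed).\<close>
primrec ppow :: "'b::ring \<Rightarrow> nat \<Rightarrow> 'b" where
  "ppow a 0 = a"
| "ppow a (Suc n) = a * ppow a n"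

definition diff_subalgebra ::
  "(complex \<Rightarrow> 'b::{real_normed_algebra,banach} \<Rightarrow> 'b) \<Rightarrow> ('b \<Rightarrow> 'b) \<Rightarrow> 'b set \<Rightarrow> ('b \<Rightarrow> real)
    \<Rightarrow> nat \<Rightarrow> real \<Rightarrow> real \<Rightarrow> bool" where
  "diff_subalgebra sm st A nA k p q \<longleftrightarrow>
     \<comment> \<open>*-subalgebra\<close>
     0 \<in> A \<and>
     (\<forall>x\<in>A. \<forall>y\<in>A. x + y \<in> A \<and> x * y \<in> A) \<and>
     (\<forall>c. \<forall>x\<in>A. sm c x \<in> A) \<and>
     (\<forall>x\<in>A. st x \<in> A) \<and>
     \<comment> \<open>nA is a Banach algebra norm on A\<close>
     (\<forall>x\<in>A. 0 \<le> nA x) \<and>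
     (\<forall>x\<in>A. nA x = 0 \<longleftrightarrow> x = 0) \<and>
     (\<forall>x\<in>A. \<forall>y\<in>A. nA (x + y) \<le> nA x + nA y) \<and>
     (\<forall>c. \<forall>x\<in>A. nA (sm c x) = cmod c * nA x) \<and>
     (\<forall>x\<in>A. \<forall>y\<in>A. nA (x * y) \<le> nA x * nA y) \<and>
     (\<forall>X::nat \<Rightarrow> 'b. (\<forall>n. X n \<in> A) \<and> (\<forall>e>0. \<exists>N. \<forall>m\<ge>N. \<forall>n\<ge>N. nA (X m - X n) < e)
          \<longrightarrow> (\<exists>L\<in>A. \<forall>e>0. \<exists>N. \<forall>n\<ge>N. nA (X n - L) < e)) \<and>
     \<comment> \<open>continuous involution\<close>
     (\<exists>M. \<forall>x\<in>A. nA (st x) \<le> M * nA x) \<and>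
     \<comment> \<open>differential norm inequality\<close>
     2 \<le> k \<and> 0 < p \<and> 0 < q \<and> p + q = real k \<and>
     (\<exists>C>0. \<forall>a\<in>A. nA (ppow a (k - 1)) \<le> C * nA a powr p * norm a powr q)"

definition unit_of :: "'b::ring set \<Rightarrow> 'b \<Rightarrow> bool" where
  "unit_of S e \<longleftrightarrow> e \<in> S \<and> (\<forall>x\<in>S. e * x = x \<and> x * e = x)"

text \<open>Multiplication in the minimal unitization D x C: (x,m)(y,n) = (xy + m y + n x, m n).\<close>
definition umult :: "(complex \<Rightarrow> 'b::ring \<Rightarrow> 'b) \<Rightarrow> 'b \<times> complex \<Rightarrow> 'b \<times> complex \<Rightarrow> 'b \<times> complex" where
  "umult sm u v = (fst u * fst v + sm (snd u) (fst v) + sm (snd v) (fst u), snd u * snd v)"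

definition spec_unital :: "(complex \<Rightarrow> 'b::ring \<Rightarrow> 'b) \<Rightarrow> 'b set \<Rightarrow> 'b \<Rightarrow> 'b \<Rightarrow> complex set" where
  "spec_unital sm D e a = {l. \<not> (\<exists>y\<in>D. (a - sm l e) * y = e \<and> y * (a - sm l e) = e)}"

definition spec_unitization :: "(complex \<Rightarrow> 'b::ring \<Rightarrow> 'b) \<Rightarrow> 'b set \<Rightarrow> 'b \<Rightarrow> complex set" where
  "spec_unitization sm D a = {l. \<not> (\<exists>y\<in>D. \<exists>v.
       umult sm (a, - l) (y, v) = (0, 1) \<and> umult sm (y, v) (a, - l) = (0, 1))}"

definition spectrum_in :: "(complex \<Rightarrow> 'b::ring \<Rightarrow> 'b) \<Rightarrow> 'b set \<Rightarrow> 'b \<Rightarrow> complex set" where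
  "spectrum_in sm D a = (if \<exists>e. unit_of D e then spec_unital sm D (THE e. unit_of D e) a
                         else spec_unitization sm D a)"

text \<open>Spectrum of a subalgebra D of the ambient algebra (the whole type), where D counts as
  unital iff it contains the unit of the ambient algebra (shared-unit convention).\<close>
definition sub_spectrum :: "(complex \<Rightarrow> 'b::ring \<Rightarrow> 'b) \<Rightarrow> 'b set \<Rightarrow> 'b \<Rightarrow> complex set" where
  "sub_spectrum sm D a = (if \<exists>e. unit_of UNIV e \<and> e \<in> D
                          then spec_unital sm D (THE e. unit_of UNIV e) a
                          else spec_unitization sm D a)"

definition symmetric_alg :: "(complex \<Rightarrow> 'b::ring \<Rightarrow> 'b) \<Rightarrow> ('b \<Rightarrow> 'b) \<Rightarrow> 'b set \<Rightarrow> bool" where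
  "symmetric_alg sm st D \<longleftrightarrow>
     (\<forall>a\<in>D. spectrum_in sm D (st a * a) \<subseteq> complex_of_real ` {0..})"

end

theory Submission
  imports Defs
begin

text \<open>Elements of the C*-algebra \<open>B\<close> act on \<open>B\<close> by left multiplication, so the unitization acts by
  bounded operators, and self-adjointness of such an operator \<open>T\<close> is read off from
  \<open>(T b)\<^sup>* c = b\<^sup>* (T c)\<close>. The only functional calculus needed is the square root of \<open>1 - T\<close> for a
  self-adjoint contraction \<open>T\<close>. It gives \<open>norm (M - y\<^sup>2) < M\<close> for invertible self-adjoint \<open>y\<close> and
  large \<open>M\<close>, and it gives positivity of \<open>a\<^sup>* a\<close>.

  The differential inequality forces \<open>s\<^bsup>n\<^esup> \<rightarrow> 0\<close> in \<open>A\<close> along powers of \<open>k\<close> whenever \<open>s \<in> A\<close> has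
  \<open>B\<close>-norm less than \<open>1\<close>, so \<open>1 - s\<close> is then invertible over \<open>A\<close>. If \<open>1 + h\<close> satisfies
  \<open>norm (M - (1 + h)) < M\<close> in \<open>B\<close>, it divides such an element \<open>1 - s\<close>. Applied to
  \<open>1 + h = ((1 + a)\<^sup>* (1 + a))\<^sup>2\<close> this yields spectral invariance, and applied to \<open>1 + h\<close> a multiple
  of \<open>a\<^sup>* a - \<lambda>\<close> or of \<open>(a\<^sup>* a - \<lambda>) (a\<^sup>* a - cnj \<lambda>)\<close> it yields symmetry. When \<open>B\<close> has a unit
  not in \<open>A\<close>, one also needs that no element of \<open>A\<close> is invertible in \<open>B\<close>; here a successive improvement
  of growth rates shows that the geometric series of partial units converges in \<open>A\<close>.\<close>

section \<open>Square roots and inverses of bounded operators\<close>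

lemmas blinfun_compose_linear_simps =
  bounded_bilinear.add_left[OF bounded_bilinear_blinfun_compose]
  bounded_bilinear.add_right[OF bounded_bilinear_blinfun_compose]
  bounded_bilinear.diff_left[OF bounded_bilinear_blinfun_compose]
  bounded_bilinear.diff_right[OF bounded_bilinear_blinfun_compose]
  bounded_bilinear.minus_left[OF bounded_bilinear_blinfun_compose]
  bounded_bilinear.minus_right[OF bounded_bilinear_blinfun_compose]
  bounded_bilinear.scaleR_left[OF bounded_bilinear_blinfun_compose]
  bounded_bilinear.scaleR_right[OF bounded_bilinear_blinfun_compose]

lemma blinfun_compose_id [simp]: "id_blinfun o\<^sub>L T = T" "T o\<^sub>L id_blinfun = T"
  by (auto intro: blinfun_eqI)

lemma blinfun_compose_assoc3: "(R o\<^sub>L S) o\<^sub>L T = R o\<^sub>L (S o\<^sub>L T)"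
  by (auto intro: blinfun_eqI)

section \<open>Commuting bounded operators\<close>

definition commutes :: "('b::real_normed_vector \<Rightarrow>\<^sub>L 'b) \<Rightarrow> ('b \<Rightarrow>\<^sub>L 'b) \<Rightarrow> bool" where
  "commutes S T \<longleftrightarrow> S o\<^sub>L T = T o\<^sub>L S"

lemma commutes_apply: "commutes S T \<Longrightarrow> blinfun_apply S (blinfun_apply T b) = blinfun_apply T (blinfun_apply S b)"
  unfolding commutes_def by (metis blinfun_apply_blinfun_compose)

lemma commutesI: "(\<And>b. blinfun_apply S (blinfun_apply T b) = blinfun_apply T (blinfun_apply S b)) \<Longrightarrow> commutes S T"
  unfolding commutes_def by (auto intro: blinfun_eqI)

lemma commutes_sym: "commutes S T \<Longrightarrow> commutes T S"
  by (simp add: commutes_def)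

lemma commutes_refl: "commutes T T"
  by (simp add: commutes_def)

lemma commutes_id: "commutes T id_blinfun"
  by (simp add: commutes_def)

lemma commutes_add: "commutes S T \<Longrightarrow> commutes S U \<Longrightarrow> commutes S (T + U)"
  by (simp add: commutes_def blinfun_compose_linear_simps)

lemma commutes_diff: "commutes S T \<Longrightarrow> commutes S U \<Longrightarrow> commutes S (T - U)"
  by (simp add: commutes_def blinfun_compose_linear_simps)

lemma commutes_scaleR: "commutes S T \<Longrightarrow> commutes S (r *\<^sub>R T)"
  by (simp add: commutes_def blinfun_compose_linear_simps)

lemma commutes_compose: "commutes S T \<Longrightarrow> commutes S U \<Longrightarrow> commutes S (T o\<^sub>L U)"
  unfolding commutes_def by (metis blinfun_compose_assoc3)

lemma commutes_inverse:
  assumes "commutes S T" "T o\<^sub>L G = id_blinfun" "G o\<^sub>L T = id_blinfun"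
  shows "commutes S G"
proof -
  have "S o\<^sub>L G = (G o\<^sub>L T) o\<^sub>L (S o\<^sub>L G)"
    by (simp add: assms)
  also have "\<dots> = G o\<^sub>L ((T o\<^sub>L S) o\<^sub>L G)"
    by (simp add: blinfun_compose_assoc3)
  also have "\<dots> = G o\<^sub>L (S o\<^sub>L (T o\<^sub>L G))"
    using assms(1) by (metis commutes_def blinfun_compose_assoc3)
  finally show ?thesis
    by (simp add: commutes_def assms)
qed

lemmas commutes_intros = commutes_refl commutes_id commutes_add commutes_diff commutes_scaleR
  commutes_compose

text \<open>The solution \<open>v\<close> of \<open>v = (T + v\<^sup>2)/2\<close>, so that \<open>(1 - v)\<^sup>2 = 1 - T\<close>. The iteration
  is majorised by its scalar version at \<open>T = 1\<close>, hence converges even when \<open>norm T = 1\<close>.\<close>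

primrec sqrt_iter :: "('b::real_normed_vector \<Rightarrow>\<^sub>L 'b) \<Rightarrow> nat \<Rightarrow> ('b \<Rightarrow>\<^sub>L 'b)" where
  "sqrt_iter T 0 = 0"
| "sqrt_iter T (Suc n) = (1/2) *\<^sub>R (T + (sqrt_iter T n o\<^sub>L sqrt_iter T n))"

primrec sqrt_major :: "nat \<Rightarrow> real" where
  "sqrt_major 0 = 0"
| "sqrt_major (Suc n) = (1/2) * (1 + sqrt_major n * sqrt_major n)"

lemma sqrt_major_bounds: "0 \<le> sqrt_major n \<and> sqrt_major n \<le> 1"
  by (induction n) (auto simp: mult_le_one)

lemma sqrt_major_incseq: "incseq sqrt_major"
proof (rule incseq_SucI)
  fix n
  show "sqrt_major n \<le> sqrt_major (Suc n)"
    \<comment> \<open>The increment is half the square of \<open>sqrt_major n - 1\<close>.\<close>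
    using zero_le_power2[of "sqrt_major n - 1"] by (simp add: power2_eq_square algebra_simps)
qed

lemma sqrt_major_Cauchy: "Cauchy sqrt_major"
proof (rule convergent_Cauchy, rule Bseq_mono_convergent)
  show "Bseq sqrt_major"
    by (rule BseqI[of 1]) (use sqrt_major_bounds in auto)
qed (use sqrt_major_incseq in \<open>auto simp: incseq_def\<close>)

lemma norm_sqrt_iter:
  assumes "norm T \<le> 1"
  shows "norm (sqrt_iter T n) \<le> sqrt_major n"
proof (induction n)
  case (Suc n)
  have "norm (sqrt_iter T n o\<^sub>L sqrt_iter T n) \<le> sqrt_major n * sqrt_major n"
    by (rule order_trans[OF norm_blinfun_compose])
      (intro mult_mono Suc.IH norm_ge_zero; use sqrt_major_bounds in auto)
  then have "norm (T + (sqrt_iter T n o\<^sub>L sqrt_iter T n)) \<le> 1 + sqrt_major n * sqrt_major n"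
    using norm_triangle_ineq[of T] assms by (meson add_mono order_trans)
  then show ?case
    by simp
qed simp

text \<open>Since v v - u u = (v - u) v + u (v - u), the norms of the operator increments obey, as
  an inequality, the recursion of the increments of \<open>sqrt_major\<close>.\<close>

lemma norm_sqrt_iter_step:
  assumes "norm T \<le> 1"
  shows "norm (sqrt_iter T (Suc n) - sqrt_iter T n) \<le> sqrt_major (Suc n) - sqrt_major n"
proof (induction n)
  case 0
  then show ?case
    using assms by simp
next
  case (Suc n)
  let ?v = "sqrt_iter T (Suc n)" and ?u = "sqrt_iter T n"
  let ?r = "sqrt_major (Suc n)" and ?q = "sqrt_major n"
  have eq: "sqrt_iter T (Suc (Suc n)) - ?v = (1/2) *\<^sub>R (((?v - ?u) o\<^sub>L ?v) + (?u o\<^sub>L (?v - ?u)))"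
  proof -
    have "sqrt_iter T (Suc (Suc n)) - ?v = (1/2) *\<^sub>R (T + (?v o\<^sub>L ?v)) - (1/2) *\<^sub>R (T + (?u o\<^sub>L ?u))"
      by (simp only: sqrt_iter.simps)
    then show ?thesis
      by (simp only: blinfun_compose_linear_simps) (simp only: algebra_simps)
  qed
  have "norm ((?v - ?u) o\<^sub>L ?v) \<le> (?r - ?q) * ?r"
    by (rule order_trans[OF norm_blinfun_compose], rule mult_mono[OF Suc.IH norm_sqrt_iter[OF assms]])
      (use sqrt_major_incseq in \<open>auto simp only: incseq_def norm_ge_zero diff_ge_0_iff_ge\<close>)
  moreover have "norm (?u o\<^sub>L (?v - ?u)) \<le> ?q * (?r - ?q)"
    by (rule order_trans[OF norm_blinfun_compose], rule mult_mono[OF norm_sqrt_iter[OF assms] Suc.IH])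
      (use sqrt_major_bounds in \<open>auto simp only: norm_ge_zero\<close>)
  ultimately have "norm (((?v - ?u) o\<^sub>L ?v) + (?u o\<^sub>L (?v - ?u))) \<le> (?r - ?q) * ?r + ?q * (?r - ?q)"
    by (meson norm_triangle_ineq add_mono order_trans)
  also have "\<dots> = 2 * (sqrt_major (Suc (Suc n)) - ?r)"
    using sqrt_major.simps(2)[of "Suc n"] sqrt_major.simps(2)[of n]
    by (simp only: sqrt_major.simps(2)[of "Suc n"]) (simp add: algebra_simps)
  finally show ?case
    unfolding eq by (simp add: norm_scaleR del: sqrt_iter.simps sqrt_major.simps)
qed

lemma norm_sqrt_iter_diff:
  assumes "norm T \<le> 1" "m \<le> n"
  shows "norm (sqrt_iter T n - sqrt_iter T m) \<le> sqrt_major n - sqrt_major m"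
  using assms(2)
proof (induction n rule: dec_induct)
  case (step n)
  have "norm (sqrt_iter T (Suc n) - sqrt_iter T m)
      \<le> norm (sqrt_iter T (Suc n) - sqrt_iter T n) + norm (sqrt_iter T n - sqrt_iter T m)"
    using norm_triangle_ineq[of "sqrt_iter T (Suc n) - sqrt_iter T n" "sqrt_iter T n - sqrt_iter T m"]
    by (simp only: diff_add_cancel add_diff_eq)
  then show ?case
    using norm_sqrt_iter_step[OF assms(1), of n] step.IH by linarith
qed simp

lemma sqrt_iter_convergent:
  fixes T :: "'b::banach \<Rightarrow>\<^sub>L 'b"
  assumes "norm T \<le> 1"
  shows "convergent (sqrt_iter T)"
proof (rule Cauchy_convergent, rule metric_CauchyI)
  fix e :: real
  assume "e > 0"
  then obtain N where N: "\<And>m n. m \<ge> N \<Longrightarrow> n \<ge> N \<Longrightarrow> dist (sqrt_major m) (sqrt_major n) < e"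
    using sqrt_major_Cauchy unfolding Cauchy_def by blast
  have *: "dist (sqrt_iter T n) (sqrt_iter T m) < e" if "N \<le> m" "m \<le> n" for m n
    using norm_sqrt_iter_diff[OF assms that(2)] N[of n m] that
    by (simp add: dist_norm)
  show "\<exists>M. \<forall>m\<ge>M. \<forall>n\<ge>M. dist (sqrt_iter T m) (sqrt_iter T n) < e"
    using * by (metis dist_commute nle_le)
qed

text \<open>The iterates are polynomials in \<open>T\<close>, so the limit commutes with whatever
  commutes with \<open>T\<close>. This is the substitute for a functional calculus.\<close>

lemma one_minus_sqrt_exists:
  fixes T :: "'b::banach \<Rightarrow>\<^sub>L 'b"
  assumes "norm T \<le> 1"
  obtains v where "sqrt_iter T \<longlonglongrightarrow> v" "(id_blinfun - v) o\<^sub>L (id_blinfun - v) = id_blinfun - T"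
    "norm v \<le> 1" "\<And>S. commutes S T \<Longrightarrow> commutes S v"
proof -
  obtain v where v: "sqrt_iter T \<longlonglongrightarrow> v"
    using sqrt_iter_convergent[OF assms] unfolding convergent_def by blast
  have "(\<lambda>n. (1/2) *\<^sub>R (T + (sqrt_iter T n o\<^sub>L sqrt_iter T n))) \<longlonglongrightarrow> (1/2) *\<^sub>R (T + (v o\<^sub>L v))"
    by (intro tendsto_intros bounded_bilinear.tendsto[OF bounded_bilinear_blinfun_compose] v)
  moreover have "(\<lambda>n. (1/2) *\<^sub>R (T + (sqrt_iter T n o\<^sub>L sqrt_iter T n))) \<longlonglongrightarrow> v"
    using LIMSEQ_Suc[OF v] by simp
  ultimately have fixpt: "(1/2) *\<^sub>R (T + (v o\<^sub>L v)) = v"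
    by (rule LIMSEQ_unique)
  have "2 *\<^sub>R ((1/2) *\<^sub>R (T + (v o\<^sub>L v))) = 2 *\<^sub>R v"
    by (simp only: fixpt)
  then have "T + (v o\<^sub>L v) = v + v"
    by (simp add: scaleR_2)
  then have "(id_blinfun - v) o\<^sub>L (id_blinfun - v) = id_blinfun - T"
    by (simp add: blinfun_compose_linear_simps algebra_simps)
  moreover have "norm v \<le> 1"
    using norm_sqrt_iter[OF assms] sqrt_major_bounds
    by (intro LIMSEQ_le_const2[OF tendsto_norm[OF v]]) (meson order_trans)
  moreover have "commutes S v" if "commutes S T" for S
  proof -
    have *: "commutes S (sqrt_iter T n)" for n
      by (induction n) (auto intro!: commutes_intros that simp: commutes_def[of S 0])
    have "(\<lambda>n. S o\<^sub>L sqrt_iter T n) \<longlonglongrightarrow> (S o\<^sub>L v)" "(\<lambda>n. sqrt_iter T n o\<^sub>L S) \<longlonglongrightarrow> (v o\<^sub>L S)"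
      by (intro bounded_bilinear.tendsto[OF bounded_bilinear_blinfun_compose] tendsto_const v)+
    moreover have "(\<lambda>n. S o\<^sub>L sqrt_iter T n) = (\<lambda>n. sqrt_iter T n o\<^sub>L S)"
      using * unfolding commutes_def by blast
    ultimately show ?thesis
      unfolding commutes_def by (simp only: LIMSEQ_unique)
  qed
  ultimately show thesis
    using that[OF v] by blast
qed

text \<open>Neumann series; the terms \<open>P n\<close> are the powers of \<open>E\<close>.\<close>

lemma blinfun_inverse_id_minus:
  fixes E :: "'b::banach \<Rightarrow>\<^sub>L 'b"
  assumes "norm E < 1"
  obtains G where "(id_blinfun - E) o\<^sub>L G = id_blinfun" "G o\<^sub>L (id_blinfun - E) = id_blinfun"
proof -
  define P where "P n = ((\<lambda>X. E o\<^sub>L X) ^^ n) id_blinfun" for n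
  have P_Suc: "P (Suc n) = E o\<^sub>L P n" for n
    by (simp add: P_def)
  have P_Suc2: "P (Suc n) = P n o\<^sub>L E" for n
  proof (induction n)
    case (Suc n)
    show ?case
      by (metis P_Suc Suc.IH blinfun_compose_assoc3)
  qed (simp add: P_def)
  have nP: "norm (P n) \<le> norm E ^ n * norm (id_blinfun :: 'b \<Rightarrow>\<^sub>L 'b)" for n
  proof (induction n)
    case (Suc n)
    have "norm (P (Suc n)) \<le> norm E * norm (P n)"
      unfolding P_Suc by (rule norm_blinfun_compose)
    also have "\<dots> \<le> norm E * (norm E ^ n * norm (id_blinfun :: 'b \<Rightarrow>\<^sub>L 'b))"
      by (rule mult_left_mono[OF Suc.IH]) simp
    finally show ?case
      by simp
  qed (simp add: P_def)
  have "summable (\<lambda>n. norm E ^ n * norm (id_blinfun :: 'b \<Rightarrow>\<^sub>L 'b))"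
    by (intro summable_mult2 summable_geometric) (use assms in simp)
  then have sP: "summable P"
    by (rule summable_comparison_test'[where N = 0]) (use nP in simp)
  have tail: "suminf P = id_blinfun + (\<Sum>n. P (Suc n))"
    using suminf_split_head[OF sP] by (simp add: P_def)
  have "E o\<^sub>L suminf P = (\<Sum>n. P (Suc n))"
    unfolding P_Suc
    by (rule bounded_linear.suminf[OF bounded_bilinear.bounded_linear_right[OF bounded_bilinear_blinfun_compose] sP])
  moreover have "suminf P o\<^sub>L E = (\<Sum>n. P (Suc n))"
    unfolding P_Suc2
    by (rule bounded_linear.suminf[OF bounded_bilinear.bounded_linear_left[OF bounded_bilinear_blinfun_compose] sP])
  ultimately have "(id_blinfun - E) o\<^sub>L suminf P = id_blinfun"
      "suminf P o\<^sub>L (id_blinfun - E) = id_blinfun"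
    using tail by (simp_all only: blinfun_compose_linear_simps(3,4) blinfun_compose_id add_diff_cancel_right')
  then show thesis
    by (rule that)
qed

section \<open>Self-adjoint operators on a C*-algebra\<close>

locale cstar =
  fixes sm :: "complex \<Rightarrow> 'b::{real_normed_algebra,banach} \<Rightarrow> 'b" and st :: "'b \<Rightarrow> 'b"
  assumes cstar: "cstar_algebra sm st"
begin

section \<open>Arithmetic of complex scalars and of the involution\<close>

lemma
  shows sm_of_real: "sm (complex_of_real r) x = r *\<^sub>R x"
    and sm_add_left: "sm (c + d) x = sm c x + sm d x"
    and sm_add_right: "sm c (x + y) = sm c x + sm c y"
    and sm_mult: "sm (c * d) x = sm c (sm d x)"
    and sm_times_left: "sm c x * y = sm c (x * y)"
    and sm_times_right: "x * sm c y = sm c (x * y)"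
    and norm_sm: "norm (sm c x) = cmod c * norm x"
    and st_st [simp]: "st (st x) = x"
    and st_add: "st (x + y) = st x + st y"
    and st_sm: "st (sm c x) = sm (cnj c) (st x)"
    and st_times: "st (x * y) = st y * st x"
    and norm_st_times: "norm (st x * x) = (norm x)\<^sup>2"
  using cstar unfolding cstar_algebra_def by metis+

lemma sm_1 [simp]: "sm 1 x = x"
  using sm_of_real[of 1 x] by simp

lemma sm_0_left [simp]: "sm 0 x = 0"
  using sm_of_real[of 0 x] by simp

lemma sm_0_right [simp]: "sm c 0 = 0"
  using sm_add_right[of c 0 0] by simp

lemma sm_minus_left: "sm (- c) x = - sm c x"
  using sm_add_left[of c "- c" x] by (simp add: eq_neg_iff_add_eq_0 add.commute)

lemma sm_minus_right: "sm c (- x) = - sm c x"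
  using sm_add_right[of c x "- x"] by (simp add: eq_neg_iff_add_eq_0 add.commute)

lemma sm_diff_right: "sm c (x - y) = sm c x - sm c y"
  using sm_add_right[of c x "- y"] by (simp add: sm_minus_right)

lemma sm_scaleR: "sm c (r *\<^sub>R x) = r *\<^sub>R sm c x"
  by (metis sm_of_real sm_mult mult.commute)

lemma st_scaleR: "st (r *\<^sub>R x) = r *\<^sub>R st x"
  by (metis sm_of_real st_sm complex_cnj_complex_of_real)

lemma st_0 [simp]: "st 0 = 0"
  using st_add[of 0 0] by simp

lemma st_minus: "st (- x) = - st x"
  using st_add[of x "- x"] by (simp add: eq_neg_iff_add_eq_0 add.commute)

lemma st_diff: "st (x - y) = st x - st y"
  using st_add[of x "- y"] by (simp add: st_minus)

lemma norm_st [simp]: "norm (st x) = norm x"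
proof -
  have *: "norm y \<le> norm (st y)" for y
  proof (cases "y = 0")
    case False
    have "norm y * norm y \<le> norm (st y) * norm y"
      using norm_mult_ineq[of "st y" y] by (simp add: norm_st_times power2_eq_square)
    then show ?thesis
      using False by simp
  qed simp
  show ?thesis
    using *[of x] *[of "st x"] by simp
qed

lemma bounded_linear_st: "bounded_linear st"
  by (rule bounded_linear_intro[where K = 1]) (simp_all add: st_add st_scaleR)

text \<open>The \<open>B\<close>-valued inner product \<open>st b * c\<close> makes \<open>B\<close>
  a Hilbert module over itself. Adjointness is a relation because a bounded operator here may fail
  to have an adjoint.\<close>

definition adjoint :: "('b \<Rightarrow>\<^sub>L 'b) \<Rightarrow> ('b \<Rightarrow>\<^sub>L 'b) \<Rightarrow> bool" where
  "adjoint S T \<longleftrightarrow> (\<forall>b c. st (blinfun_apply S b) * c = st b * blinfun_apply T c)"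

abbreviation selfadj :: "('b \<Rightarrow>\<^sub>L 'b) \<Rightarrow> bool" where
  "selfadj T \<equiv> adjoint T T"

lemma adjoint_apply: "adjoint S T \<Longrightarrow> st (blinfun_apply S b) * c = st b * blinfun_apply T c"
  by (simp add: adjoint_def)

lemma adjoint_id: "selfadj id_blinfun"
  by (simp add: adjoint_def)

lemma adjoint_0: "selfadj 0"
  by (simp add: adjoint_def)

lemma adjoint_add: "adjoint S T \<Longrightarrow> adjoint S' T' \<Longrightarrow> adjoint (S + S') (T + T')"
  by (simp add: adjoint_def blinfun.bilinear_simps st_add algebra_simps)

lemma adjoint_diff: "adjoint S T \<Longrightarrow> adjoint S' T' \<Longrightarrow> adjoint (S - S') (T - T')"
  by (simp add: adjoint_def blinfun.bilinear_simps st_diff algebra_simps)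

lemma adjoint_scaleR: "adjoint S T \<Longrightarrow> adjoint (r *\<^sub>R S) (r *\<^sub>R T)"
  by (simp add: adjoint_def blinfun.bilinear_simps st_scaleR)

lemma adjoint_compose: "adjoint S T \<Longrightarrow> adjoint S' T' \<Longrightarrow> adjoint (S o\<^sub>L S') (T' o\<^sub>L T)"
  by (simp add: adjoint_def)

lemma adjoint_sym: "adjoint S T \<Longrightarrow> adjoint T S"
  unfolding adjoint_def by (metis (no_types) st_st st_times)

lemma adjoint_mult: "adjoint (blinfun_mult_right a) (blinfun_mult_right (st a))"
  by (simp add: adjoint_def blinfun_mult_right.rep_eq st_times mult.assoc)

lemma selfadj_compose: "selfadj S \<Longrightarrow> selfadj T \<Longrightarrow> commutes S T \<Longrightarrow> selfadj (S o\<^sub>L T)"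
  using adjoint_compose[of S S T T] by (simp add: commutes_def)

lemmas adjoint_intros = adjoint_id adjoint_add adjoint_diff adjoint_scaleR

lemma selfadj_inverse:
  assumes "selfadj T" "T o\<^sub>L G = id_blinfun"
  shows "selfadj G"
  unfolding adjoint_def
proof (intro allI)
  fix b c
  have TG: "blinfun_apply T (blinfun_apply G x) = x" for x
    using assms(2) by (metis blinfun_apply_blinfun_compose blinfun_apply_id_blinfun)
  show "st (blinfun_apply G b) * c = st b * blinfun_apply G c"
    using adjoint_apply[OF assms(1), of "blinfun_apply G b" "blinfun_apply G c"] by (simp add: TG)
qed

section \<open>Self-adjoint square roots and norm estimates\<close>

lemma selfadj_LIMSEQ:
  assumes "\<And>n. selfadj (X n)" "X \<longlonglongrightarrow> T"
  shows "selfadj T"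
  unfolding adjoint_def
proof (intro allI)
  fix b c
  have X: "(\<lambda>n. blinfun_apply (X n) x) \<longlonglongrightarrow> blinfun_apply T x" for x
    by (rule blinfun.tendsto[OF assms(2) tendsto_const])
  have "(\<lambda>n. st (blinfun_apply (X n) b) * c) \<longlonglongrightarrow> st (blinfun_apply T b) * c"
    by (intro tendsto_mult bounded_linear.tendsto[OF bounded_linear_st] X tendsto_const)
  moreover have "(\<lambda>n. st b * blinfun_apply (X n) c) \<longlonglongrightarrow> st b * blinfun_apply T c"
    by (intro tendsto_mult X tendsto_const)
  ultimately show "st (blinfun_apply T b) * c = st b * blinfun_apply T c"
    using LIMSEQ_unique by (simp only: adjoint_apply[OF assms(1)]) blast
qed

text \<open>The root is \<open>id_blinfun - v\<close> with \<open>v\<close> the limit of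
  \<open>sqrt_iter T\<close>. The bound on \<open>id_blinfun - w\<close> allows the construction to
  be repeated, taking a root of \<open>w\<close> itself.\<close>

lemma selfadj_sqrt_exists:
  assumes "selfadj T" "norm T \<le> 1"
  obtains w where "selfadj w" "w o\<^sub>L w = id_blinfun - T" "norm (id_blinfun - w) \<le> 1"
    "\<And>S. commutes S T \<Longrightarrow> commutes S w"
proof -
  obtain v where v: "sqrt_iter T \<longlonglongrightarrow> v" "(id_blinfun - v) o\<^sub>L (id_blinfun - v) = id_blinfun - T"
    "norm v \<le> 1" "\<And>S. commutes S T \<Longrightarrow> commutes S v"
    using one_minus_sqrt_exists[OF assms(2)] by blast
  have "selfadj (sqrt_iter T n)" for n
    by (induction n)
      (auto intro!: adjoint_intros assms(1) selfadj_compose commutes_refl simp: adjoint_0)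
  then have "selfadj v"
    using selfadj_LIMSEQ v(1) by blast
  then show thesis
    using v by (intro that[of "id_blinfun - v"]) (auto intro!: adjoint_intros commutes_intros)
qed

text \<open>The operator \<open>z + iv\<close> is \<open>sqrt c\<close> times a unitary, and so is \<open>z - iv\<close>.\<close>

lemma norm_le_of_squares_sum:
  assumes "selfadj z" "selfadj v" "commutes z v" "(z o\<^sub>L z) + (v o\<^sub>L v) = c *\<^sub>R id_blinfun" "0 \<le> c"
  shows "(norm z)\<^sup>2 \<le> c"
proof -
  have sq: "blinfun_apply z (blinfun_apply z b) + blinfun_apply v (blinfun_apply v b) = c *\<^sub>R b" for b
    using arg_cong[OF assms(4), of "\<lambda>T. blinfun_apply T b"] by (simp add: blinfun.bilinear_simps)
  \<comment> \<open>\<open>j\<close> stands for the imaginary unit or its negative, so one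
    computation serves z + iv and z - iv.\<close>
  have unitary: "norm (blinfun_apply z b + sm j (blinfun_apply v b)) = sqrt c * norm b"
    if j: "cnj j = - j" "j * j = - 1" for b j
  proof -
    let ?z = "blinfun_apply z" and ?v = "blinfun_apply v"
    have jj: "sm j (sm j y) = - y" for y
      by (simp add: sm_mult[symmetric] j sm_minus_left)
    have "st (?z b + sm j (?v b)) * (?z b + sm j (?v b))
        = st (?z b) * ?z b + st (?v b) * ?v b + sm j (st (?z b) * ?v b - st (?v b) * ?z b)"
      by (simp add: st_add st_sm j sm_minus_left algebra_simps sm_times_left sm_times_right
          jj sm_diff_right)
    \<comment> \<open>Self-adjointness moves \<open>z\<close> and \<open>v\<close> to the right
      factor, where commutation cancels the cross terms.\<close>
    also have "\<dots> = st b * (?z (?z b) + ?v (?v b)) + sm j (st b * (?z (?v b) - ?v (?z b)))"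
      by (simp add: adjoint_apply[OF assms(1)] adjoint_apply[OF assms(2)] algebra_simps)
    also have "\<dots> = c *\<^sub>R (st b * b)"
      by (simp add: sq commutes_apply[OF assms(3)])
    finally have "(norm (?z b + sm j (?v b)))\<^sup>2 = c * (norm b)\<^sup>2"
      using assms(5) by (simp add: norm_st_times[symmetric])
    also have "\<dots> = (sqrt c * norm b)\<^sup>2"
      using assms(5) by (simp add: power_mult_distrib)
    finally show ?thesis
      using assms(5) by (simp add: power2_eq_iff_nonneg)
  qed
  have "norm (blinfun_apply z b) \<le> sqrt c * norm b" for b
  proof -
    have "2 *\<^sub>R blinfun_apply z b
        = (blinfun_apply z b + sm \<i> (blinfun_apply v b)) + (blinfun_apply z b + sm (- \<i>) (blinfun_apply v b))"
      by (simp add: scaleR_2 sm_minus_left)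
    then have "2 * norm (blinfun_apply z b) \<le> norm (blinfun_apply z b + sm \<i> (blinfun_apply v b))
        + norm (blinfun_apply z b + sm (- \<i>) (blinfun_apply v b))"
      by (metis norm_scaleR norm_triangle_ineq abs_numeral)
    then show ?thesis
      using unitary[of \<i> b] unitary[of "- \<i>" b] by simp
  qed
  then have "norm z \<le> sqrt c"
    using assms(5) by (intro norm_blinfun_bound) auto
  then show ?thesis
    using assms(5) by (metis norm_ge_zero power_mono real_sqrt_pow2)
qed

text \<open>The C*-identity applied to the vectors \<open>S b\<close>, with the adjoint moved to the
  other factor.\<close>

lemma norm_adjoint_compose:
  assumes "adjoint S T"
  shows "(norm S)\<^sup>2 \<le> norm (T o\<^sub>L S)"
proof -
  have "norm (blinfun_apply S b) \<le> sqrt (norm (T o\<^sub>L S)) * norm b" for b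
  proof -
    have "(norm (blinfun_apply S b))\<^sup>2 = norm (st b * blinfun_apply (T o\<^sub>L S) b)"
      by (simp add: norm_st_times[symmetric] adjoint_apply[OF assms])
    also have "\<dots> \<le> norm (st b) * norm (blinfun_apply (T o\<^sub>L S) b)"
      by (rule norm_mult_ineq)
    also have "\<dots> \<le> norm b * (norm (T o\<^sub>L S) * norm b)"
      using norm_blinfun[of "T o\<^sub>L S" b] by (simp add: mult_left_mono)
    also have "\<dots> = (sqrt (norm (T o\<^sub>L S)) * norm b)\<^sup>2"
      by (simp add: power_mult_distrib power2_eq_square[of "norm b"])
    finally show ?thesis
      by (rule power2_le_imp_le) simp
  qed
  then have "norm S \<le> sqrt (norm (T o\<^sub>L S))"
    by (intro norm_blinfun_bound) auto
  then show ?thesis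
    by (metis norm_ge_zero power_mono real_sqrt_pow2)
qed

lemma selfadj_square_eq_0:
  assumes "selfadj n" "n o\<^sub>L n = 0"
  shows "n = 0"
  using norm_adjoint_compose[OF assms(1)] assms(2) by simp

text \<open>If z is a self-adjoint root of c - y^2, then the squares of z and y sum to c, so
  \<open>norm_le_of_squares_sum\<close> bounds z. This replaces the order argument 0 <= c - y^2 <=
  c.\<close>

lemma norm_minus_square_le:
  assumes "selfadj y" "(norm y)\<^sup>2 \<le> c" "0 < c"
  shows "norm (c *\<^sub>R id_blinfun - (y o\<^sub>L y)) \<le> c"
proof -
  let ?T = "(1/c) *\<^sub>R (y o\<^sub>L y)"
  have "norm ?T \<le> 1"
    using norm_blinfun_compose[of y y] assms(2,3) by (simp add: field_simps power2_eq_square)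
  moreover have "selfadj ?T"
    by (intro adjoint_intros selfadj_compose assms commutes_refl)
  ultimately obtain w where w: "selfadj w" "w o\<^sub>L w = id_blinfun - ?T"
    "\<And>S. commutes S ?T \<Longrightarrow> commutes S w"
    using selfadj_sqrt_exists by blast
  have wy: "commutes y w"
    by (rule w) (intro commutes_intros)
  let ?z = "sqrt c *\<^sub>R w"
  have zz: "?z o\<^sub>L ?z = c *\<^sub>R id_blinfun - (y o\<^sub>L y)"
    using assms(3) by (simp add: blinfun_compose_linear_simps w(2) scaleR_diff_right)
  have "(norm ?z)\<^sup>2 \<le> c"
  proof (rule norm_le_of_squares_sum)
    show "commutes ?z y"
      by (intro commutes_sym[of y] commutes_intros wy)
  qed (use assms w zz in \<open>auto intro!: adjoint_intros\<close>)
  then show ?thesis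
    using norm_blinfun_compose[of ?z ?z] by (simp add: zz power2_eq_square)
qed

text \<open>As \<open>G\<close> inverts y^2, one has y^2 - \<epsilon> = y^2 (1 - \<epsilon> G), and
  z is y times a root of the second factor.\<close>

lemma square_minus_eps_exists:
  assumes "selfadj y" "selfadj G" "y o\<^sub>L y o\<^sub>L G = id_blinfun" "G o\<^sub>L (y o\<^sub>L y) = id_blinfun"
    "0 < \<epsilon>" "\<epsilon> * norm G \<le> 1" "commutes y G"
  obtains z where "selfadj z" "z o\<^sub>L z = (y o\<^sub>L y) - \<epsilon> *\<^sub>R id_blinfun"
    "\<And>S. commutes S y \<Longrightarrow> commutes S z"
proof -
  let ?T = "\<epsilon> *\<^sub>R G"
  have "norm ?T \<le> 1" "selfadj ?T"
    using assms by (auto intro: adjoint_intros)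
  then obtain s where s: "selfadj s" "s o\<^sub>L s = id_blinfun - ?T" "\<And>S. commutes S ?T \<Longrightarrow> commutes S s"
    using selfadj_sqrt_exists by blast
  have ys: "commutes y s"
    by (rule s) (intro commutes_intros assms)
  have "(y o\<^sub>L s) o\<^sub>L (y o\<^sub>L s) = (y o\<^sub>L y) o\<^sub>L (s o\<^sub>L s)"
    by (rule blinfun_eqI) (simp add: commutes_apply[OF ys])
  also have "\<dots> = (y o\<^sub>L y) - \<epsilon> *\<^sub>R id_blinfun"
    using assms(3) by (simp add: s(2) blinfun_compose_linear_simps blinfun_compose_assoc3)
  finally have "(y o\<^sub>L s) o\<^sub>L (y o\<^sub>L s) = (y o\<^sub>L y) - \<epsilon> *\<^sub>R id_blinfun" .
  moreover have "commutes S (y o\<^sub>L s)" if "commutes S y" for S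
  proof -
    have "commutes S G"
      by (rule commutes_inverse[of S "y o\<^sub>L y"])
        (use assms that in \<open>auto intro!: commutes_intros simp: blinfun_compose_assoc3\<close>)
    then show ?thesis
      by (intro commutes_intros that s(3))
  qed
  ultimately show thesis
    using s ys assms(1) by (intro that[of "y o\<^sub>L s"] selfadj_compose)
qed

text \<open>Removing a small \<epsilon> from the invertible y^2 leaves a square z^2, and M - y^2 =
  (M - \<epsilon>) - z^2. The strict gap below M is what makes the iteration in
  \<open>qinv_of_left_bound\<close> contract.\<close>

lemma norm_minus_square_less:
  assumes "selfadj y" "y o\<^sub>L g = id_blinfun" "g o\<^sub>L y = id_blinfun"
  obtains M \<epsilon> where "0 < \<epsilon>" "\<epsilon> < M" "norm (M *\<^sub>R id_blinfun - (y o\<^sub>L y)) \<le> M - \<epsilon>"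
proof -
  have g: "selfadj g"
    by (rule selfadj_inverse[OF assms(1,2)])
  let ?G = "g o\<^sub>L g"
  \<comment> \<open>Adding 1 keeps the denominator positive even if \<open>?G\<close>
    vanishes.\<close>
  define \<epsilon> where "\<epsilon> = 1 / (1 + norm ?G)"
  have \<epsilon>: "0 < \<epsilon>" "\<epsilon> * norm ?G \<le> 1"
    by (auto simp: \<epsilon>_def field_simps add_pos_nonneg)
  have yg: "blinfun_apply y (blinfun_apply g b) = b" "blinfun_apply g (blinfun_apply y b) = b" for b
    using assms(2,3) by (metis blinfun_apply_blinfun_compose blinfun_apply_id_blinfun)+
  have "y o\<^sub>L y o\<^sub>L ?G = id_blinfun" "?G o\<^sub>L (y o\<^sub>L y) = id_blinfun"
    by (rule blinfun_eqI; simp add: yg)+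
  moreover have "commutes y g"
    by (simp add: commutes_def assms)
  then have "commutes y ?G"
    by (intro commutes_intros)
  moreover have "selfadj ?G"
    by (intro selfadj_compose g commutes_refl)
  ultimately obtain z where z: "selfadj z" "z o\<^sub>L z = (y o\<^sub>L y) - \<epsilon> *\<^sub>R id_blinfun"
    using square_minus_eps_exists[OF assms(1) _ _ _ \<epsilon>] by blast
  define M where "M = \<epsilon> + (norm z)\<^sup>2 + 1"
  have "norm ((M - \<epsilon>) *\<^sub>R id_blinfun - (z o\<^sub>L z)) \<le> M - \<epsilon>"
    by (rule norm_minus_square_le[OF z(1)]) (auto simp: M_def add_nonneg_pos)
  moreover have "(M - \<epsilon>) *\<^sub>R id_blinfun - (z o\<^sub>L z) = M *\<^sub>R id_blinfun - (y o\<^sub>L y)"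
    by (simp add: z(2) algebra_simps)
  ultimately show thesis
    using \<epsilon>(1) by (intro that[of \<epsilon> M]) (auto simp: M_def add_nonneg_pos)
qed

text \<open>The number \<open>(norm y)\<^sup>2\<close> belongs to the spectrum of \<open>y\<^sup>2\<close>.\<close>

lemma norm_square_minus_square_not_invertible:
  assumes "selfadj y" "((norm y)\<^sup>2 *\<^sub>R id_blinfun - (y o\<^sub>L y)) o\<^sub>L G = id_blinfun"
    "G o\<^sub>L ((norm y)\<^sup>2 *\<^sub>R id_blinfun - (y o\<^sub>L y)) = id_blinfun"
  shows "y = 0"
proof (rule ccontr)
  assume "y \<noteq> 0"
  define c where "c = (norm y)\<^sup>2"
  have c: "c > 0"
    using \<open>y \<noteq> 0\<close> by (simp add: c_def)
  let ?D = "c *\<^sub>R id_blinfun - (y o\<^sub>L y)"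
  have DG: "?D o\<^sub>L G = id_blinfun" "G o\<^sub>L ?D = id_blinfun"
    using assms by (auto simp: c_def)
  have "selfadj ?D"
    by (intro adjoint_intros selfadj_compose commutes_refl assms)
  then have G: "selfadj G"
    using DG(1) by (rule selfadj_inverse)
  let ?T = "(1/c) *\<^sub>R (y o\<^sub>L y)"
  have "norm ?T \<le> 1"
    using norm_blinfun_compose[of y y] c by (simp add: field_simps power2_eq_square c_def)
  moreover have "selfadj ?T"
    by (intro adjoint_intros selfadj_compose assms commutes_refl)
  ultimately obtain w where w: "selfadj w" "w o\<^sub>L w = id_blinfun - ?T"
    "\<And>S. commutes S ?T \<Longrightarrow> commutes S w"
    using selfadj_sqrt_exists by blast
  let ?v = "sqrt c *\<^sub>R w"
  have vv: "?v o\<^sub>L ?v = ?D"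
    using c by (simp add: blinfun_compose_linear_simps w(2) scaleR_diff_right)
  have yv: "commutes y ?v"
    by (intro commutes_intros w(3))
  have "commutes ?v ?D"
    unfolding vv[symmetric] by (intro commutes_intros)
  then have vG: "commutes ?v G"
    using DG by (rule commutes_inverse)
  \<comment> \<open>Small enough that \<open>c - \<epsilon>\<close> stays nonnegative and that
    \<open>?D\<close> minus \<epsilon> still has a self-adjoint root.\<close>
  define \<epsilon> where "\<epsilon> = min (c/2) (1 / (1 + norm G))"
  have pos: "1 + norm G > 0"
    by (simp add: add_pos_nonneg)
  have "\<epsilon> * norm G \<le> (1 / (1 + norm G)) * norm G"
    by (rule mult_right_mono) (auto simp: \<epsilon>_def)
  also have "\<dots> \<le> 1"
    using pos by (simp add: field_simps)
  finally have \<epsilon>: "0 < \<epsilon>" "\<epsilon> < c" "\<epsilon> * norm G \<le> 1"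
    using c pos by (auto simp: \<epsilon>_def)
  have sv: "selfadj ?v"
    by (intro adjoint_intros w)
  obtain z where z: "selfadj z" "z o\<^sub>L z = (?v o\<^sub>L ?v) - \<epsilon> *\<^sub>R id_blinfun"
    "\<And>S. commutes S ?v \<Longrightarrow> commutes S z"
    by (rule square_minus_eps_exists[OF sv G _ _ \<epsilon>(1,3) vG]) (use DG vv in auto)
  \<comment> \<open>Since v^2 = c - y^2, the squares of \<open>y\<close> and \<open>z\<close> sum to
    c - \<epsilon>, which forces the square of \<open>norm y\<close> strictly below its own value
    c.\<close>
  have "(norm y)\<^sup>2 \<le> c - \<epsilon>"
    by (rule norm_le_of_squares_sum[OF assms(1) z(1) z(3)[OF yv]])
      (use \<epsilon> in \<open>auto simp: z(2) vv algebra_simps simp del: scaleR_scaleR\<close>)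
  then show False
    using \<epsilon>(1) by (simp add: c_def)
qed

section \<open>Positive operators and positivity of \<open>st a * a\<close>\<close>

text \<open>For self-adjoint operators this norm condition characterises positivity, and in this
  form sums need only the triangle inequality.\<close>

definition pos_op :: "('b \<Rightarrow>\<^sub>L 'b) \<Rightarrow> bool" where
  "pos_op P \<longleftrightarrow> (\<exists>t>0. norm (t *\<^sub>R id_blinfun - P) \<le> t)"

lemma pos_op_add:
  assumes "pos_op P" "pos_op Q"
  shows "pos_op (P + Q)"
proof -
  obtain s t where st: "s > 0" "norm (s *\<^sub>R id_blinfun - P) \<le> s" "t > 0" "norm (t *\<^sub>R id_blinfun - Q) \<le> t"
    using assms unfolding pos_op_def by blast
  have eq: "(s + t) *\<^sub>R id_blinfun - (P + Q) = (s *\<^sub>R id_blinfun - P) + (t *\<^sub>R id_blinfun - Q)"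
    by (simp add: algebra_simps)
  have "norm ((s + t) *\<^sub>R id_blinfun - (P + Q)) \<le> norm (s *\<^sub>R id_blinfun - P) + norm (t *\<^sub>R id_blinfun - Q)"
    unfolding eq by (rule norm_triangle_ineq)
  then have "norm ((s + t) *\<^sub>R id_blinfun - (P + Q)) \<le> s + t"
    using st by linarith
  then show ?thesis
    unfolding pos_op_def using st by (intro exI[of _ "s + t"]) auto
qed

lemma pos_op_square: "selfadj y \<Longrightarrow> pos_op (y o\<^sub>L y)"
  unfolding pos_op_def
  by (intro exI[of _ "(norm y)\<^sup>2 + 1"] conjI norm_minus_square_le) (auto simp: add_nonneg_pos)

text \<open>l + P = (t + l) (1 - E), where E has norm at most t / (t + l) < 1.\<close>

lemma pos_op_add_scaleR_invertible:
  assumes "pos_op P" "0 < l"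
  obtains G where "(l *\<^sub>R id_blinfun + P) o\<^sub>L G = id_blinfun" "G o\<^sub>L (l *\<^sub>R id_blinfun + P) = id_blinfun"
proof -
  obtain t where t: "t > 0" "norm (t *\<^sub>R id_blinfun - P) \<le> t"
    using assms(1) unfolding pos_op_def by blast
  let ?E = "(1 / (t + l)) *\<^sub>R (t *\<^sub>R id_blinfun - P)"
  have "norm ?E < 1"
    using t assms(2) by (simp only: norm_scaleR) (simp add: pos_divide_less_eq)
  then obtain G where G: "(id_blinfun - ?E) o\<^sub>L G = id_blinfun" "G o\<^sub>L (id_blinfun - ?E) = id_blinfun"
    using blinfun_inverse_id_minus by blast
  have "l *\<^sub>R id_blinfun + P = (t + l) *\<^sub>R (id_blinfun - ?E)"
    using t assms(2) by (simp add: scaleR_diff_right scaleR_add_left)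
  then show thesis
    using t assms(2) G
    by (intro that[of "(1 / (t + l)) *\<^sub>R G"]) (simp_all add: blinfun_compose_linear_simps(7,8))
qed

text \<open>The inverse after swapping is (1 - C G B) / l; thus B C and C B share their nonzero real
  spectrum.\<close>

lemma swap_invertible:
  fixes B C :: "'b \<Rightarrow>\<^sub>L 'b"
  assumes "(l *\<^sub>R id_blinfun + (B o\<^sub>L C)) o\<^sub>L G = id_blinfun" "G o\<^sub>L (l *\<^sub>R id_blinfun + (B o\<^sub>L C)) = id_blinfun"
    and "l \<noteq> 0"
  obtains H where "(l *\<^sub>R id_blinfun + (C o\<^sub>L B)) o\<^sub>L H = id_blinfun" "H o\<^sub>L (l *\<^sub>R id_blinfun + (C o\<^sub>L B)) = id_blinfun"
proof -
  let ?H = "(1/l) *\<^sub>R (id_blinfun - (C o\<^sub>L (G o\<^sub>L B)))"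
  have 1: "blinfun_apply B (blinfun_apply C (blinfun_apply G b)) = b - l *\<^sub>R blinfun_apply G b" for b
    using arg_cong[OF assms(1), of "\<lambda>T. blinfun_apply T b"]
    by (simp add: blinfun.bilinear_simps algebra_simps)
  have 2: "blinfun_apply G (blinfun_apply B (blinfun_apply C b)) = b - l *\<^sub>R blinfun_apply G b" for b
    using arg_cong[OF assms(2), of "\<lambda>T. blinfun_apply T b"]
    by (simp add: blinfun.bilinear_simps algebra_simps)
  show thesis
    using assms(3)
    by (intro that[of ?H]) (rule blinfun_eqI; simp add: blinfun.bilinear_simps 1 2 algebra_simps)+
qed

text \<open>The operators considered are only real linear; commuting with \<open>imag_op\<close>
  expresses complex linearity.\<close>

definition imag_op :: "'b \<Rightarrow>\<^sub>L 'b" where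
  "imag_op = Blinfun (sm \<i>)"

lemma imag_op_apply [simp]: "blinfun_apply imag_op b = sm \<i> b"
proof -
  have "bounded_linear (sm \<i>)"
    by (rule bounded_linear_intro[where K = 1]) (simp_all add: sm_add_right sm_scaleR norm_sm)
  then show ?thesis
    unfolding imag_op_def by (simp add: bounded_linear_Blinfun_apply)
qed

lemma adjoint_imag_op: "adjoint imag_op (- imag_op)"
  by (simp add: adjoint_def blinfun.bilinear_simps st_sm sm_times_left sm_times_right sm_minus_left)

lemma imag_op_square: "imag_op o\<^sub>L imag_op = - id_blinfun"
  by (rule blinfun_eqI) (simp add: blinfun.bilinear_simps sm_mult[symmetric] sm_minus_left)

text \<open>Both B + C and i (B - C) are self-adjoint, and half the sum of their squares is B C + C
  B.\<close>

lemma pos_op_swap_plus: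
  assumes "adjoint B C" "commutes imag_op B" "commutes imag_op C"
  shows "pos_op ((B o\<^sub>L C) + (C o\<^sub>L B))"
proof -
  let ?U = "(1 / sqrt 2) *\<^sub>R (B + C)" and ?D = "B - C"
  let ?V = "(1 / sqrt 2) *\<^sub>R (imag_op o\<^sub>L ?D)"
  have D: "commutes imag_op ?D"
    by (intro commutes_intros assms)
  have "selfadj ?U"
    using adjoint_scaleR[OF adjoint_add[OF assms(1) adjoint_sym[OF assms(1)]]] by (simp add: add.commute)
  moreover have "selfadj ?V"
  proof (rule adjoint_scaleR)
    have "(C - B) o\<^sub>L (- imag_op) = ?D o\<^sub>L imag_op"
      by (simp add: blinfun_compose_linear_simps)
    then show "selfadj (imag_op o\<^sub>L ?D)"
      using adjoint_compose[OF adjoint_imag_op adjoint_diff[OF assms(1) adjoint_sym[OF assms(1)]]] D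
      by (simp add: commutes_def)
  qed
  moreover have "(B o\<^sub>L C) + (C o\<^sub>L B) = (?U o\<^sub>L ?U) + (?V o\<^sub>L ?V)"
  proof -
    have "(imag_op o\<^sub>L ?D) o\<^sub>L (imag_op o\<^sub>L ?D) = (imag_op o\<^sub>L imag_op) o\<^sub>L (?D o\<^sub>L ?D)"
      by (rule blinfun_eqI) (simp only: blinfun_apply_blinfun_compose commutes_apply[OF D, symmetric])
    then have "?V o\<^sub>L ?V = - ((1/2) *\<^sub>R (?D o\<^sub>L ?D))"
      by (simp add: imag_op_square blinfun_compose_linear_simps(5-8))
    moreover have "?U o\<^sub>L ?U = (1/2) *\<^sub>R ((B + C) o\<^sub>L (B + C))"
      by (simp add: blinfun_compose_linear_simps(7,8))
    moreover have "(B o\<^sub>L C) + (C o\<^sub>L B)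
        = (1/2) *\<^sub>R (((B o\<^sub>L C) + (C o\<^sub>L B)) + ((B o\<^sub>L C) + (C o\<^sub>L B)))"
      by (metis scaleR_half_double)
    ultimately show ?thesis
      by (simp add: blinfun_compose_linear_simps algebra_simps)
  qed
  ultimately show ?thesis
    by (simp only: pos_op_add pos_op_square)
qed

text \<open>With \<open>n\<close> the negative part of \<open>a\<^sup>* a\<close> and \<open>b = a n\<close>, the operator \<open>b\<^sup>* b = - n\<^sup>3\<close> is
  negative, while \<open>b b\<^sup>* = (b b\<^sup>* + b\<^sup>* b) - b\<^sup>* b\<close> is positive. As both have the same nonzero
  spectrum, \<open>n = 0\<close>.\<close>

lemma pos_op_star_times: "pos_op (blinfun_mult_right (st a * a))"
proof -
  let ?La = "blinfun_mult_right a" and ?La' = "blinfun_mult_right (st a)"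
  define L where "L = blinfun_mult_right (st a * a)"
  have L: "L = ?La' o\<^sub>L ?La"
    by (rule blinfun_eqI) (simp add: L_def blinfun_mult_right.rep_eq mult.assoc)
  have selfL: "selfadj L"
    using adjoint_mult[of "st a * a"] by (simp add: L_def st_times)
  define M where "M = (norm L)\<^sup>2 + 1"
  have M: "M > 0" "(norm L)\<^sup>2 \<le> M"
    by (auto simp: M_def add_nonneg_pos)
  \<comment> \<open>Chosen so that \<open>id_blinfun - T\<close> is L^2 / M; its root
    \<open>w\<close>, rescaled to \<open>s\<close>, is then the absolute value of
    \<open>L\<close>.\<close>
  define T where "T = (1/M) *\<^sub>R (M *\<^sub>R id_blinfun - (L o\<^sub>L L))"
  have "norm T \<le> 1"
    using norm_minus_square_le[OF selfL M(2,1)] M(1) by (simp add: T_def)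
  moreover have "selfadj T"
    unfolding T_def by (intro adjoint_intros selfadj_compose commutes_refl selfL)
  ultimately obtain w where w: "selfadj w" "w o\<^sub>L w = id_blinfun - T" "norm (id_blinfun - w) \<le> 1"
    "\<And>S. commutes S T \<Longrightarrow> commutes S w"
    using selfadj_sqrt_exists by blast
  have "selfadj (id_blinfun - w)"
    by (intro adjoint_intros w)
  \<comment> \<open>A second root: its multiple \<open>R\<close> satisfies R^2 = s.\<close>
  then obtain r where r: "selfadj r" "r o\<^sub>L r = id_blinfun - (id_blinfun - w)"
    "\<And>S. commutes S (id_blinfun - w) \<Longrightarrow> commutes S r"
    using selfadj_sqrt_exists w(3) by blast
  define s where "s = sqrt M *\<^sub>R w"
  define R where "R = sqrt (sqrt M) *\<^sub>R r"
  have ss: "s o\<^sub>L s = L o\<^sub>L L"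
    using M(1) by (simp add: s_def w(2) T_def blinfun_compose_linear_simps(7,8) scaleR_diff_right)
  have RR: "R o\<^sub>L R = s"
    using M(1) by (simp add: s_def R_def r(2) blinfun_compose_linear_simps(7,8))
  have s_comm: "commutes S s" if "commutes S L" for S
    unfolding s_def by (intro commutes_intros w(4)) (auto simp: T_def intro!: commutes_intros that)
  have R_comm: "commutes S R" if "commutes S s" for S
  proof -
    have "w = (1 / sqrt M) *\<^sub>R s"
      using M(1) by (simp add: s_def)
    then have "commutes S w"
      using that by (metis commutes_scaleR)
    then show ?thesis
      unfolding R_def by (intro commutes_intros r(3))
  qed
  define n where "n = (1/2) *\<^sub>R (s - L)"
  have Ls: "commutes L s"
    by (intro s_comm commutes_refl)
  \<comment> \<open>Both follow from s^2 = L^2 and the commutation of \<open>s\<close> with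
    \<open>L\<close>, which give 2 n^2 = L^2 - s L.\<close>
  have nL: "n o\<^sub>L L = - (n o\<^sub>L n)" and ns: "n o\<^sub>L s = n o\<^sub>L n"
  proof -
    have "n o\<^sub>L n = (1/4) *\<^sub>R (((s o\<^sub>L s) + (L o\<^sub>L L)) - ((s o\<^sub>L L) + (L o\<^sub>L s)))"
      by (simp add: n_def blinfun_compose_linear_simps algebra_simps)
    also have "\<dots> = (1/2) *\<^sub>R ((L o\<^sub>L L) - (s o\<^sub>L L))"
    proof -
      have "(1/4) *\<^sub>R ((X + X) - (Y + Y)) = (1/2) *\<^sub>R (X - Y)" for X Y :: "'b \<Rightarrow>\<^sub>L 'b"
        by (simp add: scaleR_2[symmetric] scaleR_diff_right)
      then show ?thesis
        using Ls by (simp add: ss commutes_def)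
    qed
    finally have nn: "n o\<^sub>L n = (1/2) *\<^sub>R ((L o\<^sub>L L) - (s o\<^sub>L L))" .
    show "n o\<^sub>L L = - (n o\<^sub>L n)"
      unfolding nn by (simp add: n_def blinfun_compose_linear_simps algebra_simps)
    show "n o\<^sub>L s = n o\<^sub>L n"
      unfolding nn using Ls by (simp add: n_def blinfun_compose_linear_simps ss commutes_def)
  qed
  have selfs: "selfadj s" and selfR: "selfadj R"
    unfolding s_def R_def by (intro adjoint_intros w r)+
  have selfn: "selfadj n"
    unfolding n_def by (intro adjoint_intros selfs selfL)
  have "commutes s n"
    unfolding n_def by (intro commutes_intros commutes_sym[OF Ls])
  then have nR: "commutes n R"
    by (rule R_comm[OF commutes_sym])
  \<comment> \<open>A self-adjoint root of n^3, because R^2 = s and n s = n^2.\<close>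
  define y where "y = n o\<^sub>L R"
  have selfy: "selfadj y"
    unfolding y_def by (intro selfadj_compose selfn selfR nR)
  have yy: "y o\<^sub>L y = n o\<^sub>L (n o\<^sub>L n)"
  proof -
    have "y o\<^sub>L y = n o\<^sub>L (n o\<^sub>L (R o\<^sub>L R))"
      by (rule blinfun_eqI) (simp add: y_def commutes_apply[OF nR])
    then show ?thesis
      by (simp add: RR ns)
  qed
  define B where "B = ?La o\<^sub>L n"
  define C where "C = n o\<^sub>L ?La'"
  have BC: "adjoint B C"
    unfolding B_def C_def by (intro adjoint_compose adjoint_mult selfn)
  have "C o\<^sub>L B = (n o\<^sub>L L) o\<^sub>L n"
    by (simp add: B_def C_def L blinfun_compose_assoc3)
  then have CB: "C o\<^sub>L B = - (y o\<^sub>L y)"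
    by (simp add: nL yy blinfun_compose_assoc3 blinfun_compose_linear_simps(5))
  have imag_mult: "commutes imag_op (blinfun_mult_right c)" for c
    by (rule commutesI) (simp add: blinfun_mult_right.rep_eq sm_times_right)
  then have "commutes imag_op n"
    unfolding n_def L_def[symmetric] by (intro commutes_intros s_comm) (auto simp: L_def)
  then have "pos_op ((B o\<^sub>L C) + (C o\<^sub>L B))"
    using BC by (intro pos_op_swap_plus) (auto simp: B_def C_def intro!: commutes_intros imag_mult)
  then have "pos_op (((B o\<^sub>L C) + (C o\<^sub>L B)) + (y o\<^sub>L y))"
    by (rule pos_op_add[OF _ pos_op_square[OF selfy]])
  then have posBC: "pos_op (B o\<^sub>L C)"
    by (simp add: CB)
  have "y = 0"
  proof (rule ccontr)
    assume "y \<noteq> 0"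
    then have l: "(norm y)\<^sup>2 > 0"
      by simp
    obtain G where "((norm y)\<^sup>2 *\<^sub>R id_blinfun + (B o\<^sub>L C)) o\<^sub>L G = id_blinfun"
      "G o\<^sub>L ((norm y)\<^sup>2 *\<^sub>R id_blinfun + (B o\<^sub>L C)) = id_blinfun"
      using pos_op_add_scaleR_invertible[OF posBC l] by blast
    then obtain H where "((norm y)\<^sup>2 *\<^sub>R id_blinfun + (C o\<^sub>L B)) o\<^sub>L H = id_blinfun"
      "H o\<^sub>L ((norm y)\<^sup>2 *\<^sub>R id_blinfun + (C o\<^sub>L B)) = id_blinfun"
      using swap_invertible[of "(norm y)\<^sup>2" B C G] l by auto
    then show False
      using norm_square_minus_square_not_invertible[OF selfy, of H] \<open>y \<noteq> 0\<close> by (simp add: CB)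
  qed
  then have "n o\<^sub>L (n o\<^sub>L n) = 0"
    using yy by simp
  then have "(n o\<^sub>L n) o\<^sub>L (n o\<^sub>L n) = 0"
    by (simp add: blinfun_compose_assoc3)
  then have "n o\<^sub>L n = 0"
    by (rule selfadj_square_eq_0[OF selfadj_compose[OF selfn selfn commutes_refl]])
  then have "n = 0"
    by (rule selfadj_square_eq_0[OF selfn])
  then have "s = L"
    by (simp add: n_def)
  \<comment> \<open>Now \<open>L\<close> is its own absolute value
    \<open>sqrt M *\<^sub>R w\<close>, and the bound on \<open>id_blinfun - w\<close> becomes
    positivity.\<close>
  then have "sqrt M *\<^sub>R id_blinfun - L = sqrt M *\<^sub>R (id_blinfun - w)"
    by (simp add: s_def scaleR_diff_right)
  then have "norm (sqrt M *\<^sub>R id_blinfun - L) \<le> sqrt M"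
    using w(3) M(1) by (simp add: mult_left_le)
  then show ?thesis
    unfolding pos_op_def L_def using M(1) by (intro exI[of _ "sqrt M"]) auto
qed

end

section \<open>Quasi-inverses\<close>

text \<open>In a unitization, \<open>(1 + x) (1 + y) = 1 + circ x y\<close>.\<close>

definition circ :: "'b::ring \<Rightarrow> 'b \<Rightarrow> 'b" where
  "circ x y = x + y + x * y"

text \<open>Invertibility of 1 + x in the unitization of \<open>D\<close>, expressed inside
  \<open>D\<close> so that unital and nonunital algebras are treated alike.\<close>

definition qinv :: "'b::ring set \<Rightarrow> 'b \<Rightarrow> bool" where
  "qinv D x \<longleftrightarrow> (\<exists>y\<in>D. circ x y = 0 \<and> circ y x = 0)"

lemma circ_assoc: "circ (circ x y) z = circ x (circ y z)"
  by (simp add: circ_def algebra_simps)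

lemma circ_0 [simp]: "circ 0 x = x" "circ x 0 = x"
  by (simp_all add: circ_def)

text \<open>By associativity a left and a right inverse coincide, so a right inverse found anywhere
  lies in \<open>D\<close> once the left one does.\<close>

lemma qinvI: "y \<in> D \<Longrightarrow> circ y x = 0 \<Longrightarrow> circ x z = 0 \<Longrightarrow> qinv D x"
  unfolding qinv_def by (metis circ_assoc circ_0)

text \<open>If 1 + x and 1 + y commute, multiplying 1 + y by the inverse of the product inverts 1 +
  x.\<close>

lemma qinv_circ_factors:
  assumes "qinv D (circ x y)" "circ x y = circ y x" "\<And>u v. u \<in> D \<Longrightarrow> v \<in> D \<Longrightarrow> circ u v \<in> D" "y \<in> D"
  shows "qinv D x"
proof -
  obtain g where g: "g \<in> D" "circ (circ x y) g = 0" "circ g (circ x y) = 0"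
    using assms(1) unfolding qinv_def by blast
  have "circ x (circ y g) = 0" "circ (circ g y) x = 0"
    using g(2,3) unfolding circ_assoc[symmetric] by (simp_all add: circ_assoc assms(2))
  then show ?thesis
    by (intro qinvI[of "circ g y" D x "circ y g"] assms g)
qed

lemma ppow_commute: "ppow a n * a = a * ppow a n"
  by (induction n) (simp_all add: mult.assoc)

lemma norm_ppow_le: "norm (ppow (a::'b::real_normed_algebra) n) \<le> norm a ^ Suc n"
proof (induction n)
  case (Suc n)
  then show ?case
    using norm_mult_ineq[of a "ppow a n"] by (simp add: order_trans mult_left_mono)
qed simp

section \<open>Differential subalgebras\<close>

text \<open>If every term were at least 1, replacing p by k and taking logarithms would give ln
  x_(j+1) <= c + k ln x_j - k^(j+1) \<eta>, so (ln x_j + c) / k^j would fall by at least \<eta> at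
  each step and finally be negative.\<close>

lemma differential_recursion_less_1:
  fixes x :: "nat \<Rightarrow> real"
  assumes \<beta>: "0 < \<beta>" "\<beta> < 1" and q: "0 < q" "p \<le> real k" and k: "2 \<le> k" and C: "0 < C"
    and rec: "\<And>j. x (Suc j) \<le> C * x j powr p * (\<beta> ^ (k ^ j)) powr q"
  shows "\<exists>j. x j < 1"
proof (rule ccontr)
  assume "\<not> ?thesis"
  then have x: "x j \<ge> 1" for j
    by (simp add: not_less)
  define c where "c = \<bar>ln C\<bar>"
  define Y where "Y = ln (x 0) + c"
  define \<eta> where "\<eta> = - q * ln \<beta> / k"
  have \<eta>: "\<eta> > 0"
    using \<beta> q k by (simp add: \<eta>_def divide_neg_pos mult_pos_neg)
  have k\<eta>: "q * ln \<beta> = - k * \<eta>"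
    using k by (simp add: \<eta>_def)
  \<comment> \<open>The summand \<open>- c\<close> absorbs the constant added at each step: c - k c
    <= - c because k >= 2.\<close>
  have "ln (x j) \<le> k ^ j * (Y - j * \<eta>) - c" for j
  proof (induction j)
    case (Suc j)
    have xp: "x j > 0" "x (Suc j) > 0"
      using x[of j] x[of "Suc j"] by linarith+
    have "ln (x (Suc j)) \<le> ln (C * x j powr p * (\<beta> ^ (k ^ j)) powr q)"
      using rec[of j] xp by simp
    also have "\<dots> = ln C + p * ln (x j) + q * (k ^ j * ln \<beta>)"
      using C xp \<beta> by (simp add: ln_mult ln_powr ln_realpow)
    also have "\<dots> \<le> c + k * ln (x j) + q * (k ^ j * ln \<beta>)"
      using mult_right_mono[OF q(2), of "ln (x j)"] x[of j] by (simp add: c_def)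
    also have "\<dots> = c + k * ln (x j) - k * k ^ j * \<eta>"
      using arg_cong[OF k\<eta>, of "\<lambda>u. u * k ^ j"] by (simp add: algebra_simps)
    also have "\<dots> \<le> c + k * (k ^ j * (Y - j * \<eta>) - c) - k * k ^ j * \<eta>"
      using Suc.IH by (simp add: mult_left_mono)
    also have "\<dots> = k ^ Suc j * (Y - Suc j * \<eta>) - c - (real k - 2) * c"
      by (simp add: algebra_simps)
    also have "\<dots> \<le> k ^ Suc j * (Y - Suc j * \<eta>) - c"
      using k by (simp add: c_def)
    finally show ?case .
  qed (simp add: Y_def)
  moreover obtain j :: nat where "Y < j * \<eta>"
    using reals_Archimedean3[OF \<eta>] by blast
  then have "k ^ j * (Y - j * \<eta>) < 0"
    using k by (intro mult_pos_neg) auto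
  then have "k ^ j * (Y - j * \<eta>) - c < 0"
    unfolding c_def by linarith
  ultimately have "ln (x j) < 0"
    by (meson order_le_less_trans)
  then show False
    using x[of j] by (smt (verit) ln_ge_zero)
qed

locale differential_subalgebra = cstar sm st
  for sm :: "complex \<Rightarrow> 'b::{real_normed_algebra,banach} \<Rightarrow> 'b" and st +
  fixes A :: "'b set" and nA :: "'b \<Rightarrow> real" and k :: nat and p q :: real
  assumes diff_subalgebra: "diff_subalgebra sm st A nA k p q"
begin

section \<open>Arithmetic in \<open>A\<close> and of its norm\<close>

lemma
  shows A_0 [simp]: "0 \<in> A"
    and A_add: "x \<in> A \<Longrightarrow> y \<in> A \<Longrightarrow> x + y \<in> A"
    and A_times: "x \<in> A \<Longrightarrow> y \<in> A \<Longrightarrow> x * y \<in> A"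
    and A_sm: "x \<in> A \<Longrightarrow> sm c x \<in> A"
    and A_st: "x \<in> A \<Longrightarrow> st x \<in> A"
    and nA_ge_0: "x \<in> A \<Longrightarrow> 0 \<le> nA x"
    and nA_eq_0: "x \<in> A \<Longrightarrow> nA x = 0 \<longleftrightarrow> x = 0"
    and nA_add: "x \<in> A \<Longrightarrow> y \<in> A \<Longrightarrow> nA (x + y) \<le> nA x + nA y"
    and nA_sm: "x \<in> A \<Longrightarrow> nA (sm c x) = cmod c * nA x"
    and nA_times: "x \<in> A \<Longrightarrow> y \<in> A \<Longrightarrow> nA (x * y) \<le> nA x * nA y"
    and k_ge_2: "2 \<le> k"
    and p_pos: "0 < p" and q_pos: "0 < q" and p_plus_q: "p + q = real k"
  using diff_subalgebra unfolding diff_subalgebra_def by metis+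

lemma nA_complete:
  fixes X :: "nat \<Rightarrow> 'b"
  assumes "\<And>n. X n \<in> A" "\<And>e. e > 0 \<Longrightarrow> \<exists>N. \<forall>m\<ge>N. \<forall>n\<ge>N. nA (X m - X n) < e"
  obtains L where "L \<in> A" "\<And>e. e > 0 \<Longrightarrow> \<exists>N. \<forall>n\<ge>N. nA (X n - L) < e"
proof -
  have "\<forall>X::nat \<Rightarrow> 'b. (\<forall>n. X n \<in> A) \<and> (\<forall>e>0. \<exists>N. \<forall>m\<ge>N. \<forall>n\<ge>N. nA (X m - X n) < e)
          \<longrightarrow> (\<exists>L\<in>A. \<forall>e>0. \<exists>N. \<forall>n\<ge>N. nA (X n - L) < e)"
    using diff_subalgebra unfolding diff_subalgebra_def by (elim conjE) assumption
  from spec[OF this, of X] have "\<exists>L\<in>A. \<forall>e>0. \<exists>N. \<forall>n\<ge>N. nA (X n - L) < e"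
    using assms by simp
  then show thesis
    using that by (elim bexE) simp
qed

lemma differential_inequality:
  obtains C where "C > 0" "\<And>a. a \<in> A \<Longrightarrow> nA (ppow a (k - 1)) \<le> C * nA a powr p * norm a powr q"
proof -
  have "\<exists>C>0. \<forall>a\<in>A. nA (ppow a (k - 1)) \<le> C * nA a powr p * norm a powr q"
    using diff_subalgebra unfolding diff_subalgebra_def by (elim conjE) assumption
  then show thesis
    using that by blast
qed

lemma A_minus: "x \<in> A \<Longrightarrow> - x \<in> A"
  using A_sm[of x "- 1"] by (simp add: sm_minus_left)

lemma A_diff: "x \<in> A \<Longrightarrow> y \<in> A \<Longrightarrow> x - y \<in> A"
  using A_add[of x "- y"] A_minus[of y] by simp

lemma A_scaleR: "x \<in> A \<Longrightarrow> r *\<^sub>R x \<in> A"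
  using A_sm[of x "complex_of_real r"] by (simp add: sm_of_real)

lemma A_ppow: "x \<in> A \<Longrightarrow> ppow x n \<in> A"
  by (induction n) (auto intro: A_times)

lemma A_circ: "x \<in> A \<Longrightarrow> y \<in> A \<Longrightarrow> circ x y \<in> A"
  by (simp add: circ_def A_add A_times)

lemmas A_intros = A_add A_times A_sm A_st A_minus A_diff A_scaleR A_ppow A_circ

lemma nA_0 [simp]: "nA 0 = 0"
  by (simp add: nA_eq_0)

lemma nA_minus: "x \<in> A \<Longrightarrow> nA (- x) = nA x"
  using nA_sm[of x "- 1"] by (simp add: sm_minus_left)

lemma nA_diff: "x \<in> A \<Longrightarrow> y \<in> A \<Longrightarrow> nA (x - y) \<le> nA x + nA y"
  using nA_add[of x "- y"] by (simp add: A_minus nA_minus)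

lemma nA_minus_commute: "x \<in> A \<Longrightarrow> y \<in> A \<Longrightarrow> nA (x - y) = nA (y - x)"
  using nA_minus[of "x - y"] by (simp add: A_diff)

lemma nA_triangle: "x \<in> A \<Longrightarrow> y \<in> A \<Longrightarrow> z \<in> A \<Longrightarrow> nA (x - z) \<le> nA (x - y) + nA (y - z)"
  using nA_add[of "x - y" "y - z"] by (simp add: A_diff)

section \<open>Limits in \<open>A\<close> and quasi-inverses from norm bounds\<close>

lemma eq_0_of_geometric:
  assumes "v \<in> A" "\<And>n. nA v \<le> K * R ^ n" "0 \<le> R" "R < 1"
  shows "v = 0"
proof -
  have "(\<lambda>n. K * R ^ n) \<longlonglongrightarrow> K * 0"
    by (intro tendsto_intros LIMSEQ_realpow_zero assms)
  then have "nA v \<le> 0"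
    using assms(2) by (intro LIMSEQ_le_const[of _ 0]) auto
  then show ?thesis
    using nA_ge_0 nA_eq_0 assms(1) by force
qed

lemma geometric_limit:
  assumes X: "\<And>n. X n \<in> A" and step: "\<And>n. nA (X (Suc n) - X n) \<le> K * R ^ n" and R: "0 \<le> R" "R < 1"
  obtains L where "L \<in> A" "\<And>n. nA (X n - L) \<le> K / (1 - R) * R ^ n"
proof -
  have K: "K \<ge> 0"
    using step[of 0] nA_ge_0[of "X (Suc 0) - X 0"] X A_diff by simp
  have diff: "nA (X m - X n) \<le> K / (1 - R) * R ^ n" if "n \<le> m" for m n
  proof -
    \<comment> \<open>The telescoped form is strong enough to be carried by induction on
      \<open>m\<close>.\<close>
    have "nA (X m - X n) \<le> K / (1 - R) * (R ^ n - R ^ m)"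
      using that
    proof (induction m rule: dec_induct)
      case (step m)
      have "nA (X (Suc m) - X n) \<le> K * R ^ m + K / (1 - R) * (R ^ n - R ^ m)"
        using nA_triangle[OF X X X, of "Suc m" n m] assms(2)[of m] step.IH by linarith
      also have "\<dots> = K / (1 - R) * (R ^ n - R ^ Suc m)"
        using R by (simp add: field_simps)
      finally show ?case .
    qed simp
    also have "\<dots> \<le> K / (1 - R) * R ^ n"
      using K R by (intro mult_left_mono) auto
    finally show ?thesis .
  qed
  have lim: "(\<lambda>n. K / (1 - R) * R ^ n) \<longlonglongrightarrow> 0"
    using tendsto_mult[OF tendsto_const LIMSEQ_realpow_zero[OF R], of "K / (1 - R)"] by simp
  have "\<exists>N. \<forall>m\<ge>N. \<forall>n\<ge>N. nA (X m - X n) < e" if e: "e > 0" for e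
  proof -
    obtain N where N: "\<And>n. n \<ge> N \<Longrightarrow> K / (1 - R) * R ^ n < e"
      using order_tendstoD(2)[OF lim e] unfolding eventually_sequentially by blast
    have "nA (X m - X n) < e" if "m \<ge> N" "n \<ge> N" for m n
    proof (cases "n \<le> m")
      case True
      then show ?thesis
        using diff[of n m] N[of n] that by linarith
    next
      case False
      then show ?thesis
        using diff[of m n] N[of m] that nA_minus_commute[OF X X, of m n] by linarith
    qed
    then show ?thesis
      by blast
  qed
  then obtain L where L: "L \<in> A" "\<And>e. e > 0 \<Longrightarrow> \<exists>N. \<forall>n\<ge>N. nA (X n - L) < e"
    using nA_complete[of X, OF X] by blast
  have "nA (X n - L) \<le> K / (1 - R) * R ^ n" for n
  proof (rule field_le_epsilon)
    fix e :: real
    assume "e > 0"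
    then obtain N where N: "\<And>m. m \<ge> N \<Longrightarrow> nA (X m - L) < e"
      using L(2) by blast
    show "nA (X n - L) \<le> K / (1 - R) * R ^ n + e"
      using nA_triangle[OF X X L(1), of n "max n N"] diff[of n "max n N"] N[of "max n N"]
        nA_minus_commute[OF X X, of n "max n N"] by simp
  qed
  then show thesis
    using that L(1) by blast
qed

text \<open>Neumann series in the norm of \<open>A\<close>: \<open>X n\<close> is s + ... + s^n, and
  its limit \<open>g\<close> makes 1 + g the inverse of 1 - s.\<close>

lemma qinv_of_nA_less_1:
  assumes s: "s \<in> A" "nA s < 1"
  shows "qinv A (- s)"
proof -
  define X where "X n = ((\<lambda>y. s + s * y) ^^ n) 0" for n
  have X_Suc: "X (Suc n) = s + s * X n" for n
    by (simp add: X_def)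
  have X: "X n \<in> A" for n
    by (induction n) (auto simp: X_def intro!: A_intros s)
  have comm: "X n * s = s * X n" for n
  proof (induction n)
    case (Suc n)
    then show ?case
      unfolding X_Suc by (simp add: distrib_left distrib_right mult.assoc)
  qed (simp add: X_def)
  define R where "R = nA s"
  have R: "0 \<le> R" "R < 1"
    using s nA_ge_0 by (auto simp: R_def)
  have step: "nA (X (Suc n) - X n) \<le> R * R ^ n" for n
  proof (induction n)
    case (Suc n)
    have "X (Suc (Suc n)) - X (Suc n) = s * (X (Suc n) - X n)"
      unfolding X_Suc by (simp add: algebra_simps)
    then have "nA (X (Suc (Suc n)) - X (Suc n)) \<le> R * nA (X (Suc n) - X n)"
      unfolding R_def by (simp add: nA_times s X A_diff)
    also have "\<dots> \<le> R * (R * R ^ n)"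
      using Suc.IH R by (intro mult_left_mono)
    finally show ?case
      by simp
  qed (simp add: X_def R_def)
  obtain g where g: "g \<in> A" "\<And>n. nA (X n - g) \<le> R / (1 - R) * R ^ n"
    using geometric_limit[of X, OF X step R] by blast
  define K where "K = R / (1 - R)"
  have sg: "s * y \<in> A" "y * s \<in> A" "nA (s * y) \<le> R * nA y" "nA (y * s) \<le> R * nA y" if "y \<in> A" for y
    using that s nA_times[of s y] nA_times[of y s] by (auto simp: A_times R_def mult.commute)
  have bound: "nA (s * (g - X n)) \<le> R * (K * R ^ n)" "nA ((g - X n) * s) \<le> R * (K * R ^ n)" for n
  proof -
    have "nA (g - X n) \<le> K * R ^ n"
      using g nA_minus_commute[OF g(1) X, of n] by (simp add: K_def)
    then have "R * nA (g - X n) \<le> R * (K * R ^ n)"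
      using R by (intro mult_left_mono)
    then show "nA (s * (g - X n)) \<le> R * (K * R ^ n)" "nA ((g - X n) * s) \<le> R * (K * R ^ n)"
      using sg(3,4)[of "g - X n"] X g(1) A_diff by (meson order_trans)+
  qed
  \<comment> \<open>A fixed element bounded by a geometric null sequence, obtained by comparing
    \<open>g\<close> with \<open>X n\<close>.\<close>
  have "s + s * g - g = 0"
  proof (rule eq_0_of_geometric[OF _ _ R])
    fix n
    have "s + s * g - g = s * (g - X n) + (X (Suc n) - g)"
      unfolding X_Suc by (simp add: algebra_simps)
    then have "nA (s + s * g - g) \<le> nA (s * (g - X n)) + nA (X (Suc n) - g)"
      by (simp only: nA_add sg A_diff X g)
    also have "\<dots> \<le> R * (K * R ^ n) + K * R ^ Suc n"
      by (intro add_mono bound) (use g(2)[of "Suc n"] in \<open>simp add: K_def\<close>)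
    finally show "nA (s + s * g - g) \<le> (2 * R * K) * R ^ n"
      by (simp add: mult_ac)
  qed (intro A_intros s g)
  moreover have "s * g - g * s = 0"
  proof (rule eq_0_of_geometric[OF _ _ R])
    fix n
    have "s * g - g * s = s * (g - X n) - (g - X n) * s"
      by (simp add: algebra_simps comm)
    then have "nA (s * g - g * s) \<le> nA (s * (g - X n)) + nA ((g - X n) * s)"
      by (simp only: nA_diff sg A_diff X g)
    also have "\<dots> \<le> R * (K * R ^ n) + R * (K * R ^ n)"
      by (intro add_mono bound)
    finally show "nA (s * g - g * s) \<le> (2 * R * K) * R ^ n"
      by (simp add: mult_ac)
  qed (intro A_intros s g)
  ultimately have "circ (- s) g = 0" "circ g (- s) = 0"
    by (simp_all add: circ_def algebra_simps)
  then show ?thesis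
    unfolding qinv_def using g(1) by blast
qed

text \<open>1 - s^(n+1) = (1 - s) (1 + r) with r = s + ... + s^n, and the factors commute.\<close>

lemma qinv_of_qinv_ppow:
  assumes "s \<in> A" "qinv A (- ppow s n)"
  shows "qinv A (- s)"
proof -
  have "\<exists>r\<in>A. circ (- s) r = - ppow s n \<and> r * s = s * r"
  proof (induction n)
    case 0
    show ?case
      by (rule bexI[of _ 0]) simp_all
  next
    case (Suc n)
    then obtain r where r: "r \<in> A" "circ (- s) r = - ppow s n" "r * s = s * r"
      by blast
    show ?case
    proof (intro bexI[of _ "r + ppow s n"] conjI)
      have "circ (- s) (r + ppow s n) = circ (- s) r + (ppow s n - s * ppow s n)"
        by (simp add: circ_def algebra_simps)
      then show "circ (- s) (r + ppow s n) = - ppow s (Suc n)"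
        by (simp add: r(2))
      show "(r + ppow s n) * s = s * (r + ppow s n)"
        by (simp add: r(3) ppow_commute distrib_left distrib_right)
    qed (intro A_intros r assms)
  qed
  then obtain r where r: "r \<in> A" "circ (- s) r = - ppow s n" "r * s = s * r"
    by blast
  have comm: "circ (- s) r = circ r (- s)"
    by (simp add: circ_def r(3) add.commute)
  show ?thesis
    by (rule qinv_circ_factors[OF _ comm A_circ r(1)]) (simp_all add: r(2) assms(2))
qed

text \<open>\<open>S j\<close> is s raised to k^j, since \<open>ppow _ (k - 1)\<close> is the k-th
  power. The differential inequality makes some \<open>S j\<close> smaller than 1 in the norm of
  \<open>A\<close>, and factoring 1 - S j leads back to 1 - s.\<close>

lemma qinv_of_norm_less_1:
  assumes s: "s \<in> A" "norm s < 1"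
  shows "qinv A (- s)"
proof -
  obtain C where C: "C > 0" "\<And>a. a \<in> A \<Longrightarrow> nA (ppow a (k - 1)) \<le> C * nA a powr p * norm a powr q"
    using differential_inequality by blast
  define S where "S j = ((\<lambda>x. ppow x (k - 1)) ^^ j) s" for j
  have S_Suc: "S (Suc j) = ppow (S j) (k - 1)" for j
    by (simp add: S_def)
  have S: "S j \<in> A" for j
    by (induction j) (auto simp: S_def intro!: A_intros s)
  \<comment> \<open>The lower bound 1/2 keeps \<beta> positive when s = 0, as its logarithm is
    taken.\<close>
  define \<beta> where "\<beta> = max (norm s) (1/2)"
  have \<beta>: "0 < \<beta>" "\<beta> < 1"
    using s by (auto simp: \<beta>_def)
  have nS: "norm (S j) \<le> \<beta> ^ (k ^ j)" for j
  proof (induction j)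
    case (Suc j)
    have "norm (S (Suc j)) \<le> norm (S j) ^ k"
      using norm_ppow_le[of "S j" "k - 1"] k_ge_2 by (simp add: S_Suc)
    also have "\<dots> \<le> (\<beta> ^ (k ^ j)) ^ k"
      by (rule power_mono[OF Suc.IH]) simp
    finally show ?case
      by (simp add: power_mult[symmetric] mult.commute)
  qed (simp add: S_def \<beta>_def)
  have "\<exists>j. nA (S j) < 1"
  proof (rule differential_recursion_less_1[OF \<beta> q_pos _ k_ge_2 C(1)])
    show "p \<le> real k"
      using p_plus_q q_pos by linarith
    fix j
    have "nA (S (Suc j)) \<le> C * nA (S j) powr p * norm (S j) powr q"
      unfolding S_Suc by (rule C(2)[OF S])
    also have "\<dots> \<le> C * nA (S j) powr p * (\<beta> ^ (k ^ j)) powr q"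
      using C(1) q_pos nS by (intro mult_left_mono powr_mono2) auto
    finally show "nA (S (Suc j)) \<le> C * nA (S j) powr p * (\<beta> ^ (k ^ j)) powr q" .
  qed
  then obtain j where "qinv A (- S j)"
    using qinv_of_nA_less_1[OF S] by blast
  then show ?thesis
  proof (induction j)
    case (Suc j)
    then show ?case
      using qinv_of_qinv_ppow[OF S, of j "k - 1"] by (simp add: S_Suc)
  qed (simp add: S_def)
qed

text \<open>Here \<open>1 + h\<close> divides \<open>1 - s\<^sub>n\<close> for \<open>s\<^sub>n = - h (1 - (1 + h)/M)\<^sup>n \<in> A\<close>, and \<open>norm s\<^sub>n\<close> tends to \<open>0\<close>.\<close>

lemma qinv_of_left_bound:
  assumes h: "h \<in> A" and M: "0 < M" "\<delta> < M"
    and bound: "\<And>b. norm (M *\<^sub>R b - (b + h * b)) \<le> \<delta> * norm b"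
  shows "qinv A h"
proof -
  define c where "c = 1 / M"
  have c: "c > 0" "c * M = 1"
    using M by (auto simp: c_def)
  define F where "F y = y - c *\<^sub>R (y + h * y)" for y
  define S where "S n = (F ^^ n) (- h)" for n
  have S_Suc: "S (Suc n) = S n - c *\<^sub>R (S n + h * S n)" for n
    by (simp add: S_def F_def)
  have S: "S n \<in> A" for n
  proof (induction n)
    case (Suc n)
    then show ?case
      unfolding S_Suc by (intro A_intros h)
  qed (simp add: S_def A_minus h)
  define \<rho> where "\<rho> = c * max \<delta> 0"
  have \<rho>: "0 \<le> \<rho>" "\<rho> < 1"
    using M by (auto simp: \<rho>_def c_def)
  have F: "norm (F y) \<le> \<rho> * norm y" for y
  proof -
    have "F y = c *\<^sub>R (M *\<^sub>R y - (y + h * y))"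
      using c by (simp add: F_def scaleR_diff_right)
    then have "norm (F y) = c * norm (M *\<^sub>R y - (y + h * y))"
      using c by simp
    also have "\<dots> \<le> c * (\<delta> * norm y)"
      using c bound by (intro mult_left_mono) auto
    also have "\<dots> \<le> c * (max \<delta> 0 * norm y)"
      using c by (intro mult_left_mono mult_right_mono) auto
    finally show ?thesis
      by (simp add: \<rho>_def mult.assoc)
  qed
  have nS: "norm (S n) \<le> \<rho> ^ n * norm h" for n
  proof (induction n)
    case (Suc n)
    have "norm (S (Suc n)) \<le> \<rho> * norm (S n)"
      using F[of "S n"] by (simp add: S_def)
    also have "\<dots> \<le> \<rho> * (\<rho> ^ n * norm h)"
      using Suc.IH \<rho> by (intro mult_left_mono)
    finally show ?case
      by simp
  qed (simp add: S_def)
  have "(\<lambda>n. \<rho> ^ n * norm h) \<longlonglongrightarrow> 0 * norm h"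
    by (intro tendsto_intros LIMSEQ_realpow_zero \<rho>)
  then have "\<forall>\<^sub>F n in sequentially. \<rho> ^ n * norm h < 1"
    by (intro order_tendstoD(2)) auto
  then obtain n where "\<rho> ^ n * norm h < 1"
    unfolding eventually_sequentially by blast
  then have q: "qinv A (- S n)"
    using nS[of n] by (intro qinv_of_norm_less_1 S) linarith
  \<comment> \<open>\<open>r\<close> is c times the sum of the iterates before \<open>S n\<close>,
    so that (1 + h) (1 + r) = 1 - S n.\<close>
  have "\<exists>r\<in>A. circ h r = - S n \<and> r * h = h * r \<and> S n * h = h * S n" for n
  proof (induction n)
    case 0
    show ?case
      by (rule bexI[of _ 0]) (simp_all add: S_def)
  next
    case (Suc n)
    then obtain r where r: "r \<in> A" "circ h r = - S n" "r * h = h * r" "S n * h = h * S n"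
      by blast
    show ?case
    proof (intro bexI[of _ "r + c *\<^sub>R S n"] conjI)
      have "circ h (r + c *\<^sub>R S n) = circ h r + c *\<^sub>R (S n + h * S n)"
        by (simp add: circ_def algebra_simps)
      then show "circ h (r + c *\<^sub>R S n) = - S (Suc n)"
        unfolding S_Suc r(2) by simp
      show "(r + c *\<^sub>R S n) * h = h * (r + c *\<^sub>R S n)"
        by (simp add: distrib_left distrib_right r(3,4))
      have "h * S n * h = h * (h * S n)"
        by (simp add: mult.assoc r(4))
      then show "S (Suc n) * h = h * S (Suc n)"
        unfolding S_Suc by (simp add: right_diff_distrib left_diff_distrib distrib_left distrib_right r(4))
    qed (intro A_intros r S)
  qed
  then obtain r where r: "r \<in> A" "circ h r = - S n" "r * h = h * r"
    by blast
  have comm: "circ h r = circ r h"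
    by (simp add: circ_def r(3) add.commute)
  show ?thesis
    by (rule qinv_circ_factors[OF _ comm A_circ r(1)]) (simp_all add: r(2) q)
qed

end

text \<open>In a unital algebra, \<open>damped u j n = u\<^bsup>j+1\<^esup> (1 - u)\<^bsup>n\<^esup>\<close>.\<close>

primrec damped :: "'b::ring \<Rightarrow> nat \<Rightarrow> nat \<Rightarrow> 'b" where
  "damped u j 0 = ppow u j"
| "damped u j (Suc n) = damped u j n - u * damped u j n"

lemma damped_Suc_left: "damped u (Suc j) n = u * damped u j n"
  by (induction n) (simp_all add: right_diff_distrib)

lemma damped_mult_right: "damped u 0 n * damped u j m = damped u (Suc j) (n + m)"
proof (induction n)
  case 0
  show ?case
    by (simp only: damped_Suc_left) simp
next
  case (Suc n)
  then show ?case
    by (simp add: left_diff_distrib mult.assoc)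
qed

text \<open>With m = k - 1 this keeps the k-th power of \<open>damped u 0 n\<close> in the same
  family, where the differential inequality can be iterated.\<close>

lemma ppow_damped: "ppow (damped u 0 n) m = damped u m (n * Suc m)"
proof (induction m)
  case (Suc m)
  show ?case
    by (simp only: ppow.simps Suc.IH damped_mult_right) simp
qed simp

context differential_subalgebra
begin

section \<open>Growth rates of u^(j+1) (1 - u)^n in the norm of \<open>A\<close>\<close>

definition growth :: "'b \<Rightarrow> nat \<Rightarrow> real \<Rightarrow> bool" where
  "growth u j R \<longleftrightarrow> (\<exists>K\<ge>0. \<forall>n. nA (damped u j n) \<le> K * R ^ n)"

lemma A_damped: "u \<in> A \<Longrightarrow> damped u j n \<in> A"
  by (induction n) (auto intro: A_intros)

text \<open>Each further factor 1 - u costs at most 1 + nA u. This gives the initial rate and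
  carries bounds from multiples of \<open>k\<close> to all exponents.\<close>

lemma nA_damped_add: "u \<in> A \<Longrightarrow> nA (damped u j (m + r)) \<le> (1 + nA u) ^ r * nA (damped u j m)"
proof (induction r)
  case (Suc r)
  let ?d = "damped u j (m + r)"
  have "nA (damped u j (m + Suc r)) \<le> nA ?d + nA (u * ?d)"
    using Suc.prems by (simp add: nA_diff A_damped A_times)
  also have "\<dots> \<le> (1 + nA u) * nA ?d"
    using nA_times[of u ?d] Suc.prems by (simp add: A_damped algebra_simps)
  also have "\<dots> \<le> (1 + nA u) * ((1 + nA u) ^ r * nA (damped u j m))"
    using Suc nA_ge_0[of u] by (intro mult_left_mono) auto
  finally show ?case
    by (simp add: mult.assoc)
qed simp

lemma growth_initial:
  assumes "u \<in> A" "1 + nA u \<le> R"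
  shows "growth u 0 R"
  unfolding growth_def
proof (intro exI[of _ "nA u"] conjI allI)
  show "0 \<le> nA u"
    using assms nA_ge_0 by blast
  fix n
  have "nA (damped u 0 n) \<le> (1 + nA u) ^ n * nA u"
    using nA_damped_add[OF assms(1), of 0 0 n] by simp
  also have "\<dots> \<le> R ^ n * nA u"
    using assms nA_ge_0[of u] by (intro mult_right_mono power_mono) auto
  finally show "nA (damped u 0 n) \<le> nA u * R ^ n"
    by (simp add: mult.commute)
qed

text \<open>For a = u (1 - u)^n the norms in \<open>A\<close> and \<open>B\<close> are of order R^n
  and \<beta>^n, so the k-th power of a is of order R^(pn) \<beta>^(qn), at most the (nk)-th power
  of the new rate because p <= k and R >= 1. The price is that the index rises from 0 to k -
  1.\<close>

lemma growth_differential: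
  assumes u: "u \<in> A" and \<beta>: "0 < \<beta>" "\<And>b. norm (b - u * b) \<le> \<beta> * norm b"
    and R: "1 \<le> R" "growth u 0 R"
  shows "growth u (k - 1) (R * \<beta> powr (q / k))"
proof -
  define S where "S = R * \<beta> powr (q / k)"
  have S: "S > 0"
    using R \<beta> by (simp add: S_def)
  have Sk: "S ^ k = R ^ k * \<beta> powr q"
    using \<beta>(1) k_ge_2 by (simp add: S_def power_mult_distrib powr_power)
  obtain C where C: "C > 0" "\<And>a. a \<in> A \<Longrightarrow> nA (ppow a (k - 1)) \<le> C * nA a powr p * norm a powr q"
    using differential_inequality by blast
  obtain K where K: "K \<ge> 0" "\<And>n. nA (damped u 0 n) \<le> K * R ^ n"
    using R(2) unfolding growth_def by blast
  have nd: "norm (damped u 0 n) \<le> norm u * \<beta> ^ n" for n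
  proof (induction n)
    case (Suc n)
    have "norm (damped u 0 (Suc n)) \<le> \<beta> * norm (damped u 0 n)"
      using \<beta>(2) by simp
    also have "\<dots> \<le> \<beta> * (norm u * \<beta> ^ n)"
      using Suc.IH \<beta>(1) by (intro mult_left_mono) auto
    finally show ?case
      by (simp add: mult_ac)
  qed simp
  define C' where "C' = C * K powr p * norm u powr q"
  have C': "C' \<ge> 0"
    using C(1) by (simp add: C'_def)
  have multiples: "nA (damped u (k - 1) (n * k)) \<le> C' * S ^ (n * k)" for n
  proof -
    have "nA (damped u (k - 1) (n * k)) \<le> C * nA (damped u 0 n) powr p * norm (damped u 0 n) powr q"
      using C(2)[OF A_damped[OF u], of 0 n] k_ge_2 by (simp add: ppow_damped)
    also have "\<dots> \<le> C * (K * R ^ n) powr p * (norm u * \<beta> ^ n) powr q"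
      using C(1) K nd p_pos q_pos nA_ge_0[OF A_damped[OF u]] by (intro mult_mono powr_mono2) auto
    also have "\<dots> = C' * (R powr p) ^ n * (\<beta> powr q) ^ n"
      using K(1) R(1) \<beta>(1) by (simp add: C'_def powr_mult powr_power powr_powr
        powr_realpow[symmetric] mult_ac)
    also have "\<dots> \<le> C' * (R ^ k) ^ n * (\<beta> powr q) ^ n"
    proof -
      have "R powr p \<le> R powr k"
        using R(1) p_plus_q q_pos by (intro powr_mono) auto
      then have "R powr p \<le> R ^ k"
        using R(1) by (simp add: powr_realpow)
      then show ?thesis
        using C' by (intro mult_right_mono mult_left_mono power_mono) auto
    qed
    also have "\<dots> = C' * S ^ (n * k)"
      by (simp add: power_mult mult.commute[of n] Sk power_mult_distrib mult.assoc)
    finally show ?thesis .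
  qed
  \<comment> \<open>Pays for the remainder modulo k: each leftover factor 1 - u costs at most (1 +
    nA u) / S relative to the rate S.\<close>
  define Q where "Q = max 1 ((1 + nA u) / S)"
  have "nA (damped u (k - 1) m) \<le> C' * Q ^ k * S ^ m" for m
  proof -
    define r n where "r = m mod k" and "n = m div k"
    have m: "m = n * k + r" "r \<le> k"
      using k_ge_2 by (auto simp: r_def n_def less_imp_le)
    have "(1 + nA u) ^ r = ((1 + nA u) / S) ^ r * S ^ r"
      using S by (simp add: power_divide)
    also have "\<dots> \<le> Q ^ k * S ^ r"
    proof (intro mult_right_mono)
      have "((1 + nA u) / S) ^ r \<le> Q ^ r"
        using S nA_ge_0[OF u] by (intro power_mono) (auto simp: Q_def)
      also have "\<dots> \<le> Q ^ k"
        using m(2) by (intro power_increasing) (auto simp: Q_def)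
      finally show "((1 + nA u) / S) ^ r \<le> Q ^ k" .
    qed (use S in simp)
    finally have "(1 + nA u) ^ r * nA (damped u (k - 1) (n * k)) \<le> (Q ^ k * S ^ r) * (C' * S ^ (n * k))"
      using multiples[of n] nA_ge_0[OF u] nA_ge_0[OF A_damped[OF u]] S
      by (intro mult_mono) (auto simp: Q_def)
    then show ?thesis
      using nA_damped_add[OF u, of "k - 1" "n * k" r] by (simp add: m(1) power_add mult_ac)
  qed
  moreover have "0 \<le> C' * Q ^ k"
    using C' by (auto simp: Q_def)
  ultimately show ?thesis
    unfolding growth_def S_def by blast
qed

text \<open>The increments of \<open>damped u j\<close> are those of
  \<open>- damped u (Suc j)\<close> term by term, and a geometric sum of ratio S > 1 is dominated by
  its last term. Repetition undoes the index shift of \<open>growth_differential\<close>.\<close>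

lemma growth_pred_of_greater_1:
  assumes u: "u \<in> A" and S: "1 < S" and gr: "growth u (Suc j) S"
  shows "growth u j S"
proof -
  obtain K where K: "K \<ge> 0" "\<And>n. nA (damped u (Suc j) n) \<le> K * S ^ n"
    using gr unfolding growth_def by blast
  define K' where "K' = nA (damped u j 0) + K / (S - 1)"
  have pos: "nA (damped u j 0) \<ge> 0"
    using nA_ge_0[OF A_damped[OF u]] .
  have K': "0 \<le> K'" "K \<le> K' * (S - 1)"
    using K(1) S pos by (auto simp: K'_def distrib_right)
  have "nA (damped u j n) \<le> K' * S ^ n" for n
  proof (induction n)
    case 0
    show ?case
      using K(1) S by (simp add: K'_def)
  next
    case (Suc n)
    have "nA (damped u j (Suc n)) \<le> nA (damped u j n) + nA (damped u (Suc j) n)"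
      using nA_diff[OF A_damped[OF u] A_damped[OF u], of j n "Suc j" n] by (simp add: damped_Suc_left)
    also have "\<dots> \<le> K' * S ^ n + K * S ^ n"
      by (intro add_mono Suc.IH K)
    also have "\<dots> \<le> K' * S ^ n + (K' * (S - 1)) * S ^ n"
      using K'(2) S by (intro add_left_mono mult_right_mono) auto
    finally show ?case
      by (simp add: algebra_simps)
  qed
  then show ?thesis
    unfolding growth_def using K'(1) by blast
qed

text \<open>For S < 1 the increments are summable, so \<open>damped u j n\<close> tends to some L at
  rate S. Multiplication by u gives u L = 0, and injectivity gives L = 0.\<close>

lemma growth_pred_of_less_1:
  assumes u: "u \<in> A" and inj: "\<And>z. u * z = 0 \<Longrightarrow> z = 0"
    and S: "0 \<le> S" "S < 1" and gr: "growth u (Suc j) S"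
  shows "growth u j S"
proof -
  obtain K where K: "K \<ge> 0" "\<And>n. nA (damped u (Suc j) n) \<le> K * S ^ n"
    using gr unfolding growth_def by blast
  have "nA (damped u j (Suc n) - damped u j n) \<le> K * S ^ n" for n
    using K(2)[of n] nA_minus[OF A_damped[OF u], of "Suc j" n] by (simp add: damped_Suc_left)
  then obtain L where L: "L \<in> A" "\<And>n. nA (damped u j n - L) \<le> K / (1 - S) * S ^ n"
    using geometric_limit[of "damped u j", OF A_damped[OF u] _ S] by blast
  have "u * L = 0"
  proof (rule eq_0_of_geometric[OF _ _ S])
    fix n
    have "u * L = damped u (Suc j) n - u * (damped u j n - L)"
      by (simp add: damped_Suc_left algebra_simps)
    then have "nA (u * L) \<le> nA (damped u (Suc j) n) + nA (u * (damped u j n - L))"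
      by (simp only: nA_diff A_damped A_times A_diff u L)
    also have "\<dots> \<le> K * S ^ n + nA u * (K / (1 - S) * S ^ n)"
    proof (intro add_mono K(2))
      have "nA (u * (damped u j n - L)) \<le> nA u * nA (damped u j n - L)"
        by (intro nA_times A_diff A_damped u L)
      also have "\<dots> \<le> nA u * (K / (1 - S) * S ^ n)"
        by (intro mult_left_mono L nA_ge_0 u)
      finally show "nA (u * (damped u j n - L)) \<le> nA u * (K / (1 - S) * S ^ n)" .
    qed
    finally show "nA (u * L) \<le> (K + nA u * (K / (1 - S))) * S ^ n"
      by (simp add: distrib_right mult.assoc)
  qed (intro A_intros u L)
  then have "L = 0"
    by (rule inj)
  then show ?thesis
    unfolding growth_def using L(2) K(1) S by (intro exI[of _ "K / (1 - S)"]) auto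
qed

lemma growth_less_1_exists:
  assumes u: "u \<in> A" and \<beta>: "0 < \<beta>" "\<beta> < 1" "\<And>b. norm (b - u * b) \<le> \<beta> * norm b"
    and inj: "\<And>z. u * z = 0 \<Longrightarrow> z = 0"
  obtains S where "0 \<le> S" "S < 1" "growth u 0 S"
proof -
  \<comment> \<open>Each application of the differential inequality improves the growth rate by the factor \<open>g\<^sup>2\<close>;
    only odd powers of \<open>g\<close> occur as rates, so the rate \<open>1\<close> is skipped.\<close>
  define g where "g = sqrt (\<beta> powr (q / k))"
  have "q / k > 0"
    using q_pos k_ge_2 by simp
  then have "\<beta> powr (q / k) < 1"
    using powr_less_mono'[of \<beta> 0 "q / k"] \<beta> by simp
  then have g: "0 < g" "g < 1" "\<beta> powr (q / k) = g * g"
    using \<beta>(1) by (auto simp: g_def)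
  have step: "growth u (k - 1) (R * (g * g))" if "1 \<le> R" "growth u 0 R" for R
    using growth_differential[OF u \<beta>(1,3) that] g(3) by simp
  have g1: "1 < 1 / g"
    using g by simp
  have down: "growth u j S \<Longrightarrow> growth u 0 S" if "1 < S" for j S
  proof (induction j)
    case (Suc j)
    then show ?case
      using growth_pred_of_greater_1[OF u that] by blast
  qed
  have down': "growth u j g \<Longrightarrow> growth u 0 g" for j
  proof (induction j)
    case (Suc j)
    then show ?case
      using growth_pred_of_less_1[OF u inj less_imp_le[OF g(1)] g(2), of j] by simp
  qed
  have iter: "growth u 0 ((1 / g) ^ (2 * n + 1)) \<Longrightarrow> growth u 0 (1 / g)" for n
  proof (induction n)
    case (Suc n)
    have "1 \<le> (1 / g) ^ (2 * Suc n + 1)"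
      using g1 by (intro one_le_power) simp
    then have "growth u (k - 1) ((1 / g) ^ (2 * Suc n + 1) * (g * g))"
      using Suc.prems by (rule step)
    moreover have "(1 / g) ^ (2 * Suc n + 1) * (g * g) = (1 / g) ^ (2 * n + 1)"
      using g(1) by (simp add: field_simps)
    ultimately have "growth u 0 ((1 / g) ^ (2 * n + 1))"
      using g1 down one_less_power[OF g1, of "2 * n + 1"] by simp
    then show ?case
      by (rule Suc.IH)
  qed simp
  \<comment> \<open>The starting rate is an odd power of 1/g above 1 + nA u. After
    \<open>iter\<close> has lowered it to 1/g, one more improvement jumps over 1 to g.\<close>
  obtain n where n: "1 + nA u < (1 / g) ^ n"
    using real_arch_pow[OF g1] by blast
  also have "\<dots> \<le> (1 / g) ^ (2 * n + 1)"
    using g1 by (intro power_increasing) auto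
  finally have "growth u 0 ((1 / g) ^ (2 * n + 1))"
    by (intro growth_initial u) simp
  then have "growth u (k - 1) (1 / g * (g * g))"
    using iter g1 by (intro step) auto
  then have "growth u 0 g"
    using down' g(1) by simp
  then show thesis
    using that g by (meson less_imp_le)
qed

text \<open>f is the sum of the u (1 - u)^i, convergent in \<open>A\<close> by the growth rate below
  1; u times a partial sum is u - u (1 - u)^n.\<close>

lemma relative_unit_exists:
  assumes u: "u \<in> A" and \<beta>: "0 < \<beta>" "\<beta> < 1" "\<And>b. norm (b - u * b) \<le> \<beta> * norm b"
    and inj: "\<And>z. u * z = 0 \<Longrightarrow> z = 0"
  obtains f where "f \<in> A" "u * f = u"
proof -
  obtain S where S: "0 \<le> S" "S < 1" "growth u 0 S"
    using growth_less_1_exists[OF assms] by blast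
  then obtain K where K: "K \<ge> 0" "\<And>n. nA (damped u 0 n) \<le> K * S ^ n"
    unfolding growth_def by blast
  define E where "E n = (\<Sum>i<n. damped u 0 i)" for n
  have E: "E n \<in> A" for n
    by (induction n) (auto simp: E_def intro!: A_intros A_damped u)
  have uE: "u * E n = u - damped u 0 n" for n
    by (induction n) (simp_all add: E_def distrib_left)
  have "nA (E (Suc n) - E n) \<le> K * S ^ n" for n
    using K(2) by (simp add: E_def)
  then obtain f where f: "f \<in> A" "\<And>n. nA (E n - f) \<le> K / (1 - S) * S ^ n"
    using geometric_limit[of E, OF E _ S(1,2)] by blast
  have "u - u * f = 0"
  proof (rule eq_0_of_geometric[OF _ _ S(1,2)])
    fix n
    have "u - u * f = damped u 0 n + u * (E n - f)"
      by (simp add: right_diff_distrib uE)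
    then have "nA (u - u * f) \<le> nA (damped u 0 n) + nA (u * (E n - f))"
      by (simp only: nA_add A_damped A_times A_diff u f E)
    also have "\<dots> \<le> K * S ^ n + nA u * (K / (1 - S) * S ^ n)"
    proof (intro add_mono K(2))
      have "nA (u * (E n - f)) \<le> nA u * nA (E n - f)"
        by (intro nA_times A_diff E u f)
      also have "\<dots> \<le> nA u * (K / (1 - S) * S ^ n)"
        by (intro mult_left_mono f nA_ge_0 u)
      finally show "nA (u * (E n - f)) \<le> nA u * (K / (1 - S) * S ^ n)" .
    qed
    finally show "nA (u - u * f) \<le> (K + nA u * (K / (1 - S))) * S ^ n"
      by (simp add: distrib_right mult.assoc)
  qed (intro A_intros u f)
  then show thesis
    using that f(1) by simp
qed

end

section \<open>Spectral invariance\<close>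

lemma norm_blinfun_le: "norm T \<le> t \<Longrightarrow> norm (blinfun_apply T b) \<le> t * norm b"
  by (meson mult_right_mono norm_blinfun norm_ge_zero order_trans)

context differential_subalgebra
begin

lemma selfadj_mult: "st h = h \<Longrightarrow> selfadj (blinfun_mult_right h)"
  using adjoint_mult[of h] by simp

text \<open>Left multiplication by 1 + h is an invertible self-adjoint operator \<open>y\<close>, so
  y^2 satisfies the bound that inverts (1 + h)^2 over \<open>A\<close>; its factor 1 + h is then
  invertible too.\<close>

lemma qinv_of_qinv_UNIV_selfadj:
  assumes h: "h \<in> A" "st h = h" and q: "qinv UNIV h"
  shows "qinv A h"
proof -
  obtain g where g: "circ h g = 0" "circ g h = 0"
    using q unfolding qinv_def by blast
  define y where "y = id_blinfun + blinfun_mult_right h"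
  define G where "G = id_blinfun + blinfun_mult_right g"
  have y_apply: "blinfun_apply y b = b + h * b" and G_apply: "blinfun_apply G b = b + g * b" for b
    by (simp_all add: y_def G_def blinfun.bilinear_simps blinfun_mult_right.rep_eq)
  have expand: "(b + v * b) + u * (b + v * b) = b + circ u v * b" for u v b :: 'b
    by (simp add: circ_def algebra_simps)
  have "selfadj y"
    unfolding y_def by (intro adjoint_intros selfadj_mult h)
  moreover have "y o\<^sub>L G = id_blinfun" "G o\<^sub>L y = id_blinfun"
    by (rule blinfun_eqI; simp add: y_apply G_apply expand g)+
  ultimately obtain M \<epsilon> where M: "0 < \<epsilon>" "\<epsilon> < M" "norm (M *\<^sub>R id_blinfun - (y o\<^sub>L y)) \<le> M - \<epsilon>"
    using norm_minus_square_less by blast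
  have "qinv A (circ h h)"
  proof (rule qinv_of_left_bound[where M = M and \<delta> = "M - \<epsilon>"])
    fix b
    have "blinfun_apply (y o\<^sub>L y) b = b + circ h h * b"
      by (simp only: blinfun_apply_blinfun_compose y_apply expand)
    then show "norm (M *\<^sub>R b - (b + circ h h * b)) \<le> (M - \<epsilon>) * norm b"
      using norm_blinfun_le[OF M(3), of b]
      by (simp only: blinfun.diff_left blinfun.scaleR_left blinfun_apply_id_blinfun)
  qed (use M h in \<open>auto intro: A_circ\<close>)
  then show ?thesis
    using qinv_circ_factors[of A h h] h A_circ by blast
qed

lemma st_circ: "st (circ x y) = circ (st y) (st x)"
  by (simp add: circ_def st_add st_times add.commute)

lemma qinv_UNIV_circ: "qinv UNIV x \<Longrightarrow> qinv UNIV y \<Longrightarrow> qinv UNIV (circ x y)"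
  unfolding qinv_def by (metis UNIV_I circ_0(2) circ_assoc)

lemma qinv_UNIV_st: "qinv UNIV x \<Longrightarrow> qinv UNIV (st x)"
  unfolding qinv_def by (metis UNIV_I st_0 st_circ)

text \<open>The self-adjoint products of 1 + a with its adjoint, in either order, are invertible
  over \<open>A\<close> and supply a left and a right inverse of 1 + a.\<close>

lemma qinv_iff_qinv_UNIV:
  assumes a: "a \<in> A"
  shows "qinv A a \<longleftrightarrow> qinv UNIV a"
proof
  assume q: "qinv UNIV a"
  have "qinv A (circ (st a) a)" "qinv A (circ a (st a))"
    by (intro qinv_of_qinv_UNIV_selfadj qinv_UNIV_circ qinv_UNIV_st q A_intros a, simp add: st_circ)+
  then obtain g g' where "g \<in> A" "circ g (circ (st a) a) = 0" "circ (circ a (st a)) g' = 0"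
    unfolding qinv_def by blast
  then show "qinv A a"
    by (intro qinvI[of "circ g (st a)" A a "circ (st a) g'"]) (auto simp: circ_assoc intro: A_intros a)
qed (auto simp: qinv_def)

text \<open>For negative real l this is positivity of x = st a * a. For nonreal l, the product (x -
  l) (x - cnj l) = (x - Re l)^2 + (Im l)^2 is a square plus a positive number.\<close>

lemma qinv_star_times:
  assumes a: "a \<in> A" and l: "l \<notin> complex_of_real ` {0..}"
  shows "qinv A (sm (- 1 / l) (st a * a))"
proof -
  define x where "x = st a * a"
  have x: "x \<in> A" "st x = x"
    using a by (auto simp: x_def st_times intro: A_intros)
  have l0: "l \<noteq> 0"
    using l by force
  show ?thesis
  proof (cases "Im l = 0")
    case True
    define r where "r = - Re l"
    have lr: "l = complex_of_real (- r)"
      using True by (simp add: r_def complex_eq_iff)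
    then have r: "r > 0"
      using l by (force simp: not_le[symmetric])
    obtain t where t: "t > 0" "norm (t *\<^sub>R id_blinfun - blinfun_mult_right x) \<le> t"
      using pos_op_star_times[of a] unfolding pos_op_def x_def by blast
    have "- 1 / l = complex_of_real (1 / r)"
      using r by (simp add: lr)
    then have "sm (- 1 / l) x = (1 / r) *\<^sub>R x"
      by (simp only: sm_of_real)
    moreover have "qinv A ((1 / r) *\<^sub>R x)"
    \<comment> \<open>Here M - (1 + x / r) = (t - x) / r has norm at most t / r.\<close>
    proof (rule qinv_of_left_bound[where M = "1 + t / r" and \<delta> = "t / r"])
      fix b
      have "(1 + t / r) *\<^sub>R b - (b + (1 / r) *\<^sub>R x * b)
          = (1 / r) *\<^sub>R blinfun_apply (t *\<^sub>R id_blinfun - blinfun_mult_right x) b"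
        by (simp add: blinfun.bilinear_simps blinfun_mult_right.rep_eq algebra_simps)
      then have "norm ((1 + t / r) *\<^sub>R b - (b + (1 / r) *\<^sub>R x * b))
          = (1 / r) * norm (blinfun_apply (t *\<^sub>R id_blinfun - blinfun_mult_right x) b)"
        using r by (simp only: norm_scaleR) simp
      also have "\<dots> \<le> (1 / r) * (t * norm b)"
        using r by (intro mult_left_mono norm_blinfun_le t) simp
      finally show "norm ((1 + t / r) *\<^sub>R b - (b + (1 / r) *\<^sub>R x * b)) \<le> t / r * norm b"
        by simp
    qed (use r t x in \<open>auto intro: A_intros add_pos_pos\<close>)
    ultimately show ?thesis
      by (simp add: x_def)
  next
    case False
    define \<alpha> where "\<alpha> = Re l"
    define m where "m = (cmod l)\<^sup>2"
    have m: "m > 0"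
      using l0 by (simp add: m_def)
    have m_eq: "m = \<alpha>\<^sup>2 + (Im l)\<^sup>2"
      by (simp add: m_def \<alpha>_def cmod_power2)
    define y where "y = blinfun_mult_right x - \<alpha> *\<^sub>R id_blinfun"
    have y_apply: "blinfun_apply y b = x * b - \<alpha> *\<^sub>R b" for b
      by (simp add: y_def blinfun.bilinear_simps blinfun_mult_right.rep_eq)
    have "selfadj y"
      unfolding y_def by (intro adjoint_intros selfadj_mult x)
    then obtain t where t: "t > 0" "norm (t *\<^sub>R id_blinfun - (y o\<^sub>L y)) \<le> t"
      using pos_op_square unfolding pos_op_def by blast
    let ?h = "sm (- 1 / l) x" and ?h' = "sm (- 1 / cnj l) x"
    have lc: "l * cnj l = complex_of_real m"
      by (simp only: m_def complex_norm_square)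
    then have ll: "(1 / l) * (1 / cnj l) = complex_of_real (1 / m)"
      by simp
    have "- 1 / l + - 1 / cnj l = complex_of_real (- 2 * \<alpha> / m)"
    proof -
      have "- 1 / l + - 1 / cnj l = - (l + cnj l) / (l * cnj l)"
        using l0 by (simp add: field_simps)
      also have "\<dots> = complex_of_real (- 2 * \<alpha> / m)"
        by (simp add: complex_add_cnj \<alpha>_def lc)
      finally show ?thesis .
    qed
    then have add: "?h + ?h' = (- 2 * \<alpha> / m) *\<^sub>R x"
      by (metis sm_add_left sm_of_real)
    have times: "?h * ?h' = (1 / m) *\<^sub>R (x * x)" "?h' * ?h = (1 / m) *\<^sub>R (x * x)"
      by (simp_all only: sm_times_left sm_times_right sm_mult[symmetric])
        (use ll in \<open>simp_all add: mult.commute sm_of_real[symmetric]\<close>)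
    have circ: "circ ?h ?h' = (1 / m) *\<^sub>R (x * x - (2 * \<alpha>) *\<^sub>R x)"
      unfolding circ_def add times by (simp add: scaleR_diff_right)
    have circ_comm: "circ ?h ?h' = circ ?h' ?h"
      unfolding circ_def times by (simp add: add.commute)
    \<comment> \<open>1 + circ is (y^2 + (Im l)^2) / m, and subtracting it from the chosen M leaves
      (t - y^2) / m, of norm at most t / m.\<close>
    have "qinv A (circ ?h ?h')"
    proof (rule qinv_of_left_bound[where M = "(t + (Im l)\<^sup>2) / m" and \<delta> = "t / m"])
      fix b :: 'b
      have "t - \<alpha>\<^sup>2 = t + (Im l)\<^sup>2 - m"
        by (simp add: m_eq)
      then have "(t + (Im l)\<^sup>2) / m - 1 = (t - \<alpha>\<^sup>2) / m"
        using m by (simp only: diff_divide_distrib) simp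
      then have "((t + (Im l)\<^sup>2) / m) *\<^sub>R b - b = ((t - \<alpha>\<^sup>2) / m) *\<^sub>R b"
        by (metis scaleR_left_diff_distrib scaleR_one)
      then have "((t + (Im l)\<^sup>2) / m) *\<^sub>R b - (b + circ ?h ?h' * b)
          = ((t - \<alpha>\<^sup>2) / m) *\<^sub>R b - circ ?h ?h' * b"
        by (simp only: diff_diff_eq[symmetric])
      also have "\<dots> = (1 / m) *\<^sub>R ((t - \<alpha>\<^sup>2) *\<^sub>R b - (x * (x * b) - (2 * \<alpha>) *\<^sub>R (x * b)))"
        unfolding circ by (simp add: scaleR_diff_right left_diff_distrib mult.assoc)
      also have "\<dots> = (1 / m) *\<^sub>R blinfun_apply (t *\<^sub>R id_blinfun - (y o\<^sub>L y)) b"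
        by (simp add: blinfun.bilinear_simps y_apply algebra_simps power2_eq_square scaleR_2[symmetric])
      finally have "norm (((t + (Im l)\<^sup>2) / m) *\<^sub>R b - (b + circ ?h ?h' * b))
          = (1 / m) * norm (blinfun_apply (t *\<^sub>R id_blinfun - (y o\<^sub>L y)) b)"
        using m by (simp only: norm_scaleR) simp
      also have "\<dots> \<le> (1 / m) * (t * norm b)"
        using m by (intro mult_left_mono norm_blinfun_le t) simp
      finally show "norm (((t + (Im l)\<^sup>2) / m) *\<^sub>R b - (b + circ ?h ?h' * b)) \<le> t / m * norm b"
        by simp
    next
      show "0 < (t + (Im l)\<^sup>2) / m" "t / m < (t + (Im l)\<^sup>2) / m"
        using m t False by (auto intro!: divide_pos_pos add_pos_nonneg divide_strict_right_mono)
    qed (intro A_intros x)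
    then show ?thesis
      using qinv_circ_factors[OF _ circ_comm A_circ] A_sm[OF x(1)] by (simp add: x_def)
  qed
qed

text \<open>A scaled square u of \<open>st a * a\<close> is injective and close to the unit of
  \<open>B\<close>, so it has a relative unit f in \<open>A\<close>. From u (f - e) = 0 follows f =
  e.\<close>

lemma unit_mem_of_invertible:
  assumes e: "unit_of UNIV e" and a: "a \<in> A" and y: "a * y = e" "y * a = e"
  shows "e \<in> A"
proof -
  have e1: "e * b = b" "b * e = b" for b
    using e by (auto simp: unit_of_def)
  have ste: "st e = e"
    by (metis e1 st_st st_times)
  define x where "x = st a * a"
  have x: "x \<in> A" "st x = x"
    using a by (auto simp: x_def st_times intro: A_intros)
  define g where "g = y * st y"
  have xg: "x * g = e"
  proof -
    have "x * g = st a * (a * y) * st y"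
      by (simp add: x_def g_def mult.assoc)
    also have "\<dots> = st (y * a)"
      by (simp add: y e1 st_times[symmetric])
    finally show ?thesis
      by (simp add: y ste)
  qed
  have gx: "g * x = e"
  proof -
    have "g * x = y * (st y * st a) * a"
      by (simp add: x_def g_def mult.assoc)
    then show ?thesis
      by (simp add: st_times[symmetric] y ste e1)
  qed
  let ?L = "blinfun_mult_right x" and ?G = "blinfun_mult_right g"
  have "?L o\<^sub>L ?G = id_blinfun" "?G o\<^sub>L ?L = id_blinfun"
    by (rule blinfun_eqI; simp add: blinfun_mult_right.rep_eq mult.assoc[symmetric] xg gx e1)+
  then obtain M \<epsilon> where M: "0 < \<epsilon>" "\<epsilon> < M" "norm (M *\<^sub>R id_blinfun - (?L o\<^sub>L ?L)) \<le> M - \<epsilon>"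
    using norm_minus_square_less[OF selfadj_mult[OF x(2)]] by blast
  define u where "u = (1 / M) *\<^sub>R (x * x)"
  have u: "u \<in> A"
    unfolding u_def by (intro A_intros x)
  have inj: "z = 0" if "u * z = 0" for z
  proof -
    have "x * (x * z) = 0"
      using that M by (simp add: u_def mult.assoc)
    then have "g * (g * (x * (x * z))) = 0"
      by simp
    then show ?thesis
      by (metis gx e1(1) mult.assoc)
  qed
  have "norm (b - u * b) \<le> (1 - \<epsilon> / M) * norm b" for b
  proof -
    have "b - u * b = (1 / M) *\<^sub>R blinfun_apply (M *\<^sub>R id_blinfun - (?L o\<^sub>L ?L)) b"
      using M by (simp add: u_def blinfun.bilinear_simps blinfun_mult_right.rep_eq scaleR_diff_right mult.assoc)
    then have "norm (b - u * b) = (1 / M) * norm (blinfun_apply (M *\<^sub>R id_blinfun - (?L o\<^sub>L ?L)) b)"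
      using M by (simp only: norm_scaleR) simp
    also have "\<dots> \<le> (1 / M) * ((M - \<epsilon>) * norm b)"
      using M by (intro mult_left_mono norm_blinfun_le) auto
    finally show ?thesis
      using M by (simp add: field_simps)
  qed
  then obtain f where f: "f \<in> A" "u * f = u"
    using relative_unit_exists[OF u _ _ _ inj, of "1 - \<epsilon> / M"] M by auto
  have "u * (f - e) = 0"
    by (simp add: right_diff_distrib f e1)
  then show ?thesis
    using inj f(1) by force
qed

end

section \<open>Spectra in terms of quasi-inverses\<close>

context cstar
begin

lemma unit_of_the: "unit_of D e \<Longrightarrow> (THE e. unit_of D e) = e"
  unfolding unit_of_def by (rule the_equality) metis+

text \<open>At l = 0 the scalar part of a product with (a, 0) vanishes, so it is never 1. Otherwise
  a - l = - l (1 - a / l), and the scalar part of an inverse must be - 1 / l.\<close>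

lemma spec_unitization_iff:
  assumes D: "\<And>c x. x \<in> D \<Longrightarrow> sm c x \<in> D"
  shows "l \<in> spec_unitization sm D a \<longleftrightarrow> l = 0 \<or> \<not> qinv D (sm (- 1 / l) a)"
proof (cases "l = 0")
  case True
  then show ?thesis
    by (simp add: spec_unitization_def umult_def)
next
  case False
  define v where "v = - 1 / l"
  have lv: "- l * v = 1" "v * - l = 1"
    using False by (simp_all add: v_def)
  have v_unique: "w = v" if "- l * w = 1" for w
    using that lv(1) False by (metis mult_cancel_left neg_equal_0_iff_equal)
  have um: "umult sm (a, - l) (sm v g, v) = (circ (sm v a) g, 1)"
    "umult sm (sm v g, v) (a, - l) = (circ g (sm v a), 1)" for g
    by (simp_all only: umult_def fst_conv snd_conv sm_mult[symmetric] lv sm_times_left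
        sm_times_right sm_1 circ_def) (simp_all add: add_ac)
  have "(\<exists>y\<in>D. \<exists>w. umult sm (a, - l) (y, w) = (0, 1) \<and> umult sm (y, w) (a, - l) = (0, 1))
      \<longleftrightarrow> qinv D (sm v a)"
  proof
    assume "\<exists>y\<in>D. \<exists>w. umult sm (a, - l) (y, w) = (0, 1) \<and> umult sm (y, w) (a, - l) = (0, 1)"
    then obtain y w where y: "y \<in> D" "umult sm (a, - l) (y, w) = (0, 1)" "umult sm (y, w) (a, - l) = (0, 1)"
      by blast
    have "w = v"
      using y(2) by (intro v_unique) (simp add: umult_def)
    moreover have "y = sm v (sm (- l) y)"
      by (simp only: sm_mult[symmetric] lv sm_1)
    ultimately have "circ (sm v a) (sm (- l) y) = 0" "circ (sm (- l) y) (sm v a) = 0"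
      using y(2,3) um[of "sm (- l) y"] by simp_all
    then show "qinv D (sm v a)"
      unfolding qinv_def using D[OF y(1)] by blast
  next
    assume "qinv D (sm v a)"
    then obtain g where "g \<in> D" "circ (sm v a) g = 0" "circ g (sm v a) = 0"
      unfolding qinv_def by blast
    then show "\<exists>y\<in>D. \<exists>w. umult sm (a, - l) (y, w) = (0, 1) \<and> umult sm (y, w) (a, - l) = (0, 1)"
      using um[of g] D by (intro bexI[of _ "sm v g"] exI[of _ v]) simp_all
  qed
  then show ?thesis
    using False by (simp only: spec_unitization_def mem_Collect_eq v_def simp_thms)
qed

text \<open>The substitution y = e + g turns inverses into quasi-inverses. This form includes l = 0,
  as the case of a shared unit requires.\<close>

lemma spec_unital_iff:
  assumes D: "\<And>x y. x \<in> D \<Longrightarrow> y \<in> D \<Longrightarrow> x + y \<in> D" "\<And>x y. x \<in> D \<Longrightarrow> y \<in> D \<Longrightarrow> x - y \<in> D"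
      "\<And>c x. x \<in> D \<Longrightarrow> sm c x \<in> D"
    and e: "unit_of D e" and a: "a \<in> D"
  shows "l \<in> spec_unital sm D e a \<longleftrightarrow> \<not> qinv D (a - sm l e - e)"
proof -
  have eD: "e \<in> D" and e1: "\<And>x. x \<in> D \<Longrightarrow> e * x = x" "\<And>x. x \<in> D \<Longrightarrow> x * e = x"
    using e by (auto simp: unit_of_def)
  define h where "h = a - sm l e - e"
  have h: "h \<in> D" "a - sm l e = e + h"
    by (auto simp: h_def intro!: D eD a)
  have prod: "(e + h) * (e + g) = e + circ h g" "(e + g) * (e + h) = e + circ g h" if "g \<in> D" for g
    using that h eD by (simp_all add: circ_def distrib_left distrib_right e1 add_ac)
  have "(\<exists>y\<in>D. (e + h) * y = e \<and> y * (e + h) = e) \<longleftrightarrow> qinv D h"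
  proof
    assume "\<exists>y\<in>D. (e + h) * y = e \<and> y * (e + h) = e"
    then obtain y where y: "y \<in> D" "(e + h) * y = e" "y * (e + h) = e"
      by blast
    have "y - e \<in> D"
      by (intro D y eD)
    moreover from prod[OF this] y have "circ h (y - e) = 0" "circ (y - e) h = 0"
      by simp_all
    ultimately show "qinv D h"
      unfolding qinv_def by blast
  next
    assume "qinv D h"
    then obtain g where "g \<in> D" "circ h g = 0" "circ g h = 0"
      unfolding qinv_def by blast
    then show "\<exists>y\<in>D. (e + h) * y = e \<and> y * (e + h) = e"
      using prod[of g] by (intro bexI[of _ "e + g"] conjI D eD) simp_all
  qed
  moreover have "l \<in> spec_unital sm D e a \<longleftrightarrow> \<not> (\<exists>y\<in>D. (e + h) * y = e \<and> y * (e + h) = e)"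
    by (simp only: spec_unital_def mem_Collect_eq h(2))
  ultimately show ?thesis
    by (simp only: h_def)
qed

text \<open>Dividing by - l yields the criterion of \<open>spec_unitization_iff\<close>, so the two
  notions of spectrum agree away from 0.\<close>

lemma spec_unital_iff_nonzero:
  assumes D: "\<And>x y. x \<in> D \<Longrightarrow> y \<in> D \<Longrightarrow> x + y \<in> D" "\<And>x y. x \<in> D \<Longrightarrow> y \<in> D \<Longrightarrow> x - y \<in> D"
      "\<And>c x. x \<in> D \<Longrightarrow> sm c x \<in> D"
    and e: "unit_of D e" and a: "a \<in> D" and l: "l \<noteq> 0"
  shows "l \<in> spec_unital sm D e a \<longleftrightarrow> \<not> qinv D (sm (- 1 / l) a)"
proof -
  have eD: "e \<in> D" and e1: "\<And>x. x \<in> D \<Longrightarrow> e * x = x" "\<And>x. x \<in> D \<Longrightarrow> x * e = x"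
    using e by (auto simp: unit_of_def)
  define v where "v = - 1 / l"
  have lv: "v * l = - 1" "v * - l = 1"
    using l by (simp_all add: v_def)
  have prod: "(a - sm l e) * sm v (e + g) = e + circ (sm v a) g"
      "sm v (e + g) * (a - sm l e) = e + circ g (sm v a)" if "g \<in> D" for g
  proof -
    have eq: "sm v (a - sm l e) = sm v a + e"
      by (simp add: sm_diff_right sm_mult[symmetric] lv sm_minus_left)
    have "(a - sm l e) * sm v (e + g) = sm v (a - sm l e) * (e + g)"
      by (simp only: sm_times_left sm_times_right)
    then show "(a - sm l e) * sm v (e + g) = e + circ (sm v a) g"
      unfolding eq using that eD a D by (simp add: circ_def distrib_left distrib_right e1 add_ac)
    have "sm v (e + g) * (a - sm l e) = (e + g) * sm v (a - sm l e)"
      by (simp only: sm_times_left sm_times_right)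
    then show "sm v (e + g) * (a - sm l e) = e + circ g (sm v a)"
      unfolding eq using that eD a D by (simp add: circ_def distrib_left distrib_right e1 add_ac)
  qed
  have "(\<exists>y\<in>D. (a - sm l e) * y = e \<and> y * (a - sm l e) = e) \<longleftrightarrow> qinv D (sm v a)"
  proof
    assume "\<exists>y\<in>D. (a - sm l e) * y = e \<and> y * (a - sm l e) = e"
    then obtain y where y: "y \<in> D" "(a - sm l e) * y = e" "y * (a - sm l e) = e"
      by blast
    define g where "g = sm (- l) y - e"
    have g: "g \<in> D"
      unfolding g_def by (intro D y eD)
    have "e + g = sm (- l) y"
      by (simp add: g_def)
    then have "sm v (e + g) = y"
      by (simp only: sm_mult[symmetric] lv sm_1)
    then have "circ (sm v a) g = 0" "circ g (sm v a) = 0"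
      using prod[OF g] y by simp_all
    then show "qinv D (sm v a)"
      unfolding qinv_def using g by blast
  next
    assume "qinv D (sm v a)"
    then obtain g where "g \<in> D" "circ (sm v a) g = 0" "circ g (sm v a) = 0"
      unfolding qinv_def by blast
    then show "\<exists>y\<in>D. (a - sm l e) * y = e \<and> y * (a - sm l e) = e"
      using prod[of g] by (intro bexI[of _ "sm v (e + g)"] conjI D eD) simp_all
  qed
  then show ?thesis
    by (simp only: spec_unital_def mem_Collect_eq v_def)
qed

end

section \<open>Comparison of the spectra, and symmetry\<close>

context differential_subalgebra
begin

lemma sub_spectrum_eq:
  assumes a: "a \<in> A"
  shows "sub_spectrum sm A a = spectrum_in sm UNIV a"
proof (cases "\<exists>e. unit_of (UNIV :: 'b set) e")
  case False
  then show ?thesis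
    using qinv_iff_qinv_UNIV[OF A_sm[OF a]]
    by (auto simp: sub_spectrum_def spectrum_in_def spec_unitization_iff A_sm)
next
  case True
  then obtain e where e: "unit_of (UNIV :: 'b set) e"
    by blast
  have the_e: "(THE e. unit_of (UNIV :: 'b set) e) = e"
    by (rule unit_of_the[OF e])
  show ?thesis
  proof (cases "e \<in> A")
    case True
    have eA: "unit_of A e"
      using e True by (simp add: unit_of_def)
    have "qinv A (a - sm l e - e) \<longleftrightarrow> qinv UNIV (a - sm l e - e)" for l
      by (intro qinv_iff_qinv_UNIV A_intros a True)
    then have "spec_unital sm A e a = spec_unital sm UNIV e a"
      using spec_unital_iff[OF A_add A_diff A_sm eA a] spec_unital_iff[OF _ _ _ e, of a] by blast
    then show ?thesis
      using e True by (auto simp: sub_spectrum_def spectrum_in_def the_e)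
  next
    case False
    have "\<nexists>e. unit_of UNIV e \<and> e \<in> A"
      using False unit_of_the the_e by metis
    then have sub: "sub_spectrum sm A a = spec_unitization sm A a"
      unfolding sub_spectrum_def by (rule if_not_P)
    have UNIV: "spectrum_in sm UNIV a = spec_unital sm UNIV e a"
      using e by (auto simp: spectrum_in_def the_e)
    have "l \<in> spec_unitization sm A a \<longleftrightarrow> l \<in> spec_unital sm UNIV e a" for l
    proof (cases "l = 0")
      case True
      \<comment> \<open>An \<open>a\<close> invertible in \<open>B\<close> would bring the unit of
        \<open>B\<close> into \<open>A\<close>.\<close>
      have "0 \<in> spec_unital sm UNIV e a"
        using unit_mem_of_invertible[OF e a] False by (auto simp: spec_unital_def)
      then show ?thesis
        using True by (simp add: spec_unitization_iff A_sm)
    next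
      case False
      then show ?thesis
        using qinv_iff_qinv_UNIV[OF A_sm[OF a]] spec_unital_iff_nonzero[OF _ _ _ e _ False, of a]
        by (simp add: spec_unitization_iff A_sm)
    qed
    then show ?thesis
      unfolding sub UNIV by blast
  qed
qed

lemma symmetric_subalgebra: "symmetric_alg sm st A"
  unfolding symmetric_alg_def
proof (intro ballI subsetI)
  fix a l
  assume a: "a \<in> A" and l: "l \<in> spectrum_in sm A (st a * a)"
  show "l \<in> complex_of_real ` {0..}"
  proof (rule ccontr)
    assume nonpos: "l \<notin> complex_of_real ` {0..}"
    then have l0: "l \<noteq> 0"
      by force
    have q: "qinv A (sm (- 1 / l) (st a * a))"
      by (rule qinv_star_times[OF a nonpos])
    have x: "st a * a \<in> A"
      by (intro A_intros a)
    show False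
    \<comment> \<open>This unit is that of \<open>A\<close> itself and may differ from a unit of
      \<open>B\<close>; quasi-invertibility refers to neither.\<close>
    proof (cases "\<exists>e. unit_of A e")
      case True
      then obtain e where e: "unit_of A e"
        by blast
      have "l \<in> spec_unital sm A e (st a * a)"
        using l True by (simp add: spectrum_in_def unit_of_the[OF e])
      then show False
        using spec_unital_iff_nonzero[OF A_add A_diff A_sm e x l0] q by blast
    next
      case False
      then show False
        using l l0 q by (simp add: spectrum_in_def spec_unitization_iff A_sm)
    qed
  qed
qed

end

theorem theorem3p3:
  fixes sm :: "complex \<Rightarrow> 'b::{real_normed_algebra,banach} \<Rightarrow> 'b"
    and st :: "'b \<Rightarrow> 'b" and A :: "'b set" and nA :: "'b \<Rightarrow> real"
    and k :: nat and p q :: real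
  assumes "cstar_algebra sm st"
    and "diff_subalgebra sm st A nA k p q"
  shows "(\<forall>a\<in>A. sub_spectrum sm A a = spectrum_in sm UNIV a) \<and> symmetric_alg sm st A"
proof -
  interpret differential_subalgebra sm st A nA k p q
    by unfold_locales (rule assms)+
  show ?thesis
    using sub_spectrum_eq symmetric_subalgebra by blast
qed

end
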